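(* The outer approximation algorithm OA (described in the context) solves the problem (MIQP) exactly in a finite number of iterations: it terminates after finitely many iterations, and the solution $(x^T,\eta^T)$ it returns satisfies $\eta^T=\mathrm{OPT}$, where $\mathrm{OPT}$ is the optimal value of (MIQP).
   Context: (MIQP): minimize $y^\top Qy+g^\top y+h^\top x$ over $(x,y)$ subject to $Ay\le b$, $Cy\le Dx$, $y_i(1-x_i)=0$ for $i=1,\dots,n$, $x\in X\subseteq\{0,1\}^n$; here $Q\in\mathbb{R}^{n\times n}$ is positive definite, $g,h\in\mathbb{R}^n$, $A\in\mathbb{R}^{m_1\times n}$, $b\in\mathbb{R}^{m_1}$, $C,D\in\mathbb{R}^{m_2\times n}$. Standing assumption: (MIQP) is feasible. Decomposition: $Q=R+\mathrm{diag}(\delta)$ with $\delta\ge0$ and $R$ positive semidefinite; for cut procedure (b) below, moreover, $R=\sum_{i=1}^KL_iL_i^\top+N$ with $L_i\in\mathbb{R}^n$ the columns of $L\in\mathbb{R}^{n\times K}$, $1\le K\le n$, and $N$ positive semidefinite. The quotient $y_i^2/x_i$ is the closed perspective function: $y_i^2/x_i$ if $x_i>0$, $0$ if $x_i=y_i=0$, $+\infty$ otherwise. Define $$f_{\mathrm{persp}}(x,y)=y^\top Ry+\sum_{i=1}^n\delta_i\frac{y_i^2}{x_i}+g^\top y+h^\top x\ \text{ if }Ay\le b,\ Cy\le Dx,\qquad f_{\mathrm{persp}}(x,y)=+\infty\text{ otherwise},$$ $\bar f_{\mathrm{persp}}(x)=\inf_{y\in\mathbb{R}^n}f_{\mathrm{persp}}(x,y)$,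 and let $\eta_{\mathrm{persp}}$ be the optimal value of the perspective relaxation, i.e. of minimizing $f_{\mathrm{persp}}(x,y)$ over $x\in\mathrm{conv}(X)$, $y\in\mathbb{R}^n$. Algorithm OA: start with $\mathcal Z_1=\{(x,y,\eta):Ay\le b,\ Cy\le Dx,\ x\in\mathrm{conv}(X),\ \eta\ge\eta_{\mathrm{persp}}\}$. At iteration $t=1,2,\dots$ compute the solution $(x^t,\eta^t)$ of the master problem $\min\{\eta:x\in X,\ (x,y,\eta)\in\mathcal Z_t\text{ for some }y\}$. If $\eta^t\ge\bar f_{\mathrm{persp}}(x^t)$, stop and return $(x^t,\eta^t)$. Otherwise compute a vector $\tau^t\in\mathbb{R}^n$ at $x=x^t$ by one of the two cut procedures below, set $\mathcal Z_{t+1}=\mathcal Z_t\cap\{(x,y,\eta):\eta\ge\langle\tau^t,x-x^t\rangle+\bar f_{\mathrm{persp}}(x^t)\}$, and continue with $t+1$. Cut procedures at $x$. Notation: $H_i$ is the $i$th column of a matrix $H$; subscript $S$ on $A,C$ selects columns, on $R$ the principal submatrix, on vectors the subvector. Let $S=\{i:x_i>0\}$, $S^C=[n]\setminus S$; set $y_i=0$ for $i\in S^C$ and let $(y_S,\lambda,\mu)$ be the optimal primal-dual solution of $$\min_{\tilde y\in\mathbb{R}^{|S|}}\ \tilde y^\top\big(R_S+\mathrm{diag}(\{\delta_i/x_i\}_{i\in S})\big)\tilde y+g_S^\top\tilde y\quad\text{s.t. }A_S\tilde y\le b,\ C_S\tilde y\le Dx,$$ with $\lambda,\mu$ the multipliers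 of the two groups of constraints. Put $\tau_i=-\delta_iy_i^2/x_i^2-\mu^\top D_i+h_i$ for $i\in S$ and $r_i=-2\sum_{j\in S}R_{ij}y_j-g_i-\lambda^\top A_i-\mu^\top C_i$ for $i\in S^C$. (a) Perspective cut: for $i\in S^C$, $\Psi_i=\frac1{\delta_i}r_i$ and $\tau_i=-\frac{\delta_i}4\Psi_i^2-\mu^\top D_i+h_i$. (b) Perspective and rank-one cut: let $I^0=\{i\in\{1,\dots,K\}:\sum_{1\le l\le n,\,L_{li}\ne0}x_l=0\}$ and $n_i=|\{j:L_{ji}\ne0\}|$ for $i\in I^0$; solve $\big(\mathrm{diag}(\{\delta_i\}_{i\in S^C})+\sum_{i\in I^0}\frac1{n_i}(L_i)_{S^C}(L_i)_{S^C}^\top\big)\beta=2r$; set $\Psi_i=\frac12\beta_i$ for $i\in S^C$, $\psi_i=\frac1{2n_i}\sum_{j\in S^C}L_{ji}\beta_j$ for $i\in I^0$, and $\tau_i=-\frac{\delta_i}4\Psi_i^2-\frac14\sum_{j\in I^0,\,L_{ij}\ne0}\psi_j^2-\mu^\top D_i+h_i$ for $i\in S^C$.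
   Formalization: Only runs whose requested cuts can be computed are covered: OA as stated can get stuck if the subproblem at x^t is infeasible (f̄_persp(x^t)=+∞), if δ_i=0 for some i outside S in (a), or if the system in (b) is singular. Also δ_i·(+∞) is read as +∞ when δ_i=0. *)

theory Defs
  imports "HOL-Analysis.Analysis"
begin

definition pos_semidef :: "real^'n^'n \<Rightarrow> bool" where
  "pos_semidef M \<longleftrightarrow> transpose M = M \<and> (\<forall>v. 0 \<le> v \<bullet> (M *v v))"

definition pos_def :: "real^'n^'n \<Rightarrow> bool" where
  "pos_def M \<longleftrightarrow> transpose M = M \<and> (\<forall>v. v \<noteq> 0 \<longrightarrow> 0 < v \<bullet> (M *v v))"

definition diag_mat :: "real^'n \<Rightarrow> real^'n^'n" where
  "diag_mat d = (\<chi> i j. if i = j then d $ i else 0)"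

record ('n::finite, 'm1::finite, 'm2::finite) miqp =
  Qmat :: "real^'n^'n"
  gvec :: "real^'n"
  hvec :: "real^'n"
  Amat :: "real^'n^'m1"
  bvec :: "real^'m1"
  Cmat :: "real^'n^'m2"
  Dmat :: "real^'n^'m2"
  Xset :: "(real^'n) set"

definition miqp_feasible ::
    "('n::finite,'m1::finite,'m2::finite) miqp \<Rightarrow> real^'n \<Rightarrow> real^'n \<Rightarrow> bool" where
  "miqp_feasible M x y \<longleftrightarrow>
     x \<in> Xset M \<and> Amat M *v y \<le> bvec M \<and> Cmat M *v y \<le> Dmat M *v x \<and>
     (\<forall>i. y $ i * (1 - x $ i) = 0)"

definition miqp_opt :: "('n::finite,'m1::finite,'m2::finite) miqp \<Rightarrow> ereal" where
  "miqp_opt M = (INF (x, y) \<in> {(x, y). miqp_feasible M x y}.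
     ereal (y \<bullet> (Qmat M *v y) + gvec M \<bullet> y + hvec M \<bullet> x))"

definition persp_quot :: "real \<Rightarrow> real \<Rightarrow> ereal" where
  "persp_quot y x =
     (if x > 0 then ereal (y\<^sup>2 / x) else if x = 0 \<and> y = 0 then 0 else \<infinity>)"

text \<open>The product of a weight \<open>d \<ge> 0\<close> with an infinite quotient is infinite also for \<open>d = 0\<close>
  (whereas \<open>0 * \<infinity> = 0\<close> in \<^typ>\<open>ereal\<close>), so \<open>y = 0\<close> is enforced wherever \<open>x = 0\<close>.\<close>

definition persp_term :: "real \<Rightarrow> real \<Rightarrow> real \<Rightarrow> ereal" where
  "persp_term d y x = (if persp_quot y x = \<infinity> then \<infinity> else ereal d * persp_quot y x)"

definition f_persp ::
    "('n::finite,'m1::finite,'m2::finite) miqp \<Rightarrow> real^'n^'n \<Rightarrow> real^'n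
      \<Rightarrow> real^'n \<Rightarrow> real^'n \<Rightarrow> ereal" where
  "f_persp M R \<delta> x y =
     (if Amat M *v y \<le> bvec M \<and> Cmat M *v y \<le> Dmat M *v x
      then ereal (y \<bullet> (R *v y)) + (\<Sum>i\<in>UNIV. persp_term (\<delta> $ i) (y $ i) (x $ i))
             + ereal (gvec M \<bullet> y) + ereal (hvec M \<bullet> x)
      else \<infinity>)"

definition fbar_persp ::
    "('n::finite,'m1::finite,'m2::finite) miqp \<Rightarrow> real^'n^'n \<Rightarrow> real^'n \<Rightarrow> real^'n \<Rightarrow> ereal" where
  "fbar_persp M R \<delta> x = (INF y. f_persp M R \<delta> x y)"

definition eta_persp ::
    "('n::finite,'m1::finite,'m2::finite) miqp \<Rightarrow> real^'n^'n \<Rightarrow> real^'n \<Rightarrow> ereal" where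
  "eta_persp M R \<delta> = (INF (x, y) \<in> (convex hull Xset M) \<times> UNIV. f_persp M R \<delta> x y)"

definition pos_supp :: "real^'n \<Rightarrow> 'n set" where
  "pos_supp x = {i. x $ i > 0}"

text \<open>A vector indexed by \<open>S = pos_supp x\<close>, or by its complement, is represented by a vector
  indexed by the whole type of which only the relevant coordinates are read.\<close>

definition sub_obj ::
    "('n::finite,'m1::finite,'m2::finite) miqp \<Rightarrow> real^'n^'n \<Rightarrow> real^'n
      \<Rightarrow> real^'n \<Rightarrow> real^'n \<Rightarrow> real" where
  "sub_obj M R \<delta> x y =
     (\<Sum>i\<in>pos_supp x. \<Sum>j\<in>pos_supp x.
        y $ i * (R $ i $ j + (if i = j then \<delta> $ i / x $ i else 0)) * y $ j)
     + (\<Sum>i\<in>pos_supp x. gvec M $ i * y $ i)"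

definition sub_lhs :: "real^'n^'m \<Rightarrow> real^'n \<Rightarrow> real^'n \<Rightarrow> real^'m" where
  "sub_lhs H x y = (\<Sum>i\<in>pos_supp x. y $ i *\<^sub>R column i H)"

definition sub_feasible ::
    "('n::finite,'m1::finite,'m2::finite) miqp \<Rightarrow> real^'n \<Rightarrow> real^'n \<Rightarrow> bool" where
  "sub_feasible M x y \<longleftrightarrow>
     sub_lhs (Amat M) x y \<le> bvec M \<and> sub_lhs (Cmat M) x y \<le> Dmat M *v x"

text \<open>A minimiser, extended by zero outside \<open>S\<close>, together with Lagrange multipliers:
  sign conditions, complementary slackness and stationarity of the Lagrangian.\<close>

definition sub_primal_dual ::
    "('n::finite,'m1::finite,'m2::finite) miqp \<Rightarrow> real^'n^'n \<Rightarrow> real^'n \<Rightarrow> real^'n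
      \<Rightarrow> real^'n \<Rightarrow> real^'m1 \<Rightarrow> real^'m2 \<Rightarrow> bool" where
  "sub_primal_dual M R \<delta> x y lam mu \<longleftrightarrow>
     (\<forall>i. i \<notin> pos_supp x \<longrightarrow> y $ i = 0) \<and>
     sub_feasible M x y \<and>
     (\<forall>z. sub_feasible M x z \<longrightarrow> sub_obj M R \<delta> x y \<le> sub_obj M R \<delta> x z) \<and>
     0 \<le> lam \<and> 0 \<le> mu \<and>
     (\<forall>k. lam $ k * (sub_lhs (Amat M) x y - bvec M) $ k = 0) \<and>
     (\<forall>k. mu $ k * (sub_lhs (Cmat M) x y - Dmat M *v x) $ k = 0) \<and>
     (\<forall>i\<in>pos_supp x.
        2 * (\<Sum>j\<in>pos_supp x. R $ i $ j * y $ j) + 2 * (\<delta> $ i / x $ i) * y $ i + gvec M $ i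
        + lam \<bullet> column i (Amat M) + mu \<bullet> column i (Cmat M) = 0)"

definition cut_residual ::
    "('n::finite,'m1::finite,'m2::finite) miqp \<Rightarrow> real^'n^'n \<Rightarrow> real^'n
      \<Rightarrow> real^'n \<Rightarrow> real^'m1 \<Rightarrow> real^'m2 \<Rightarrow> 'n \<Rightarrow> real" where
  "cut_residual M R x y lam mu i =
     - 2 * (\<Sum>j\<in>pos_supp x. R $ i $ j * y $ j) - gvec M $ i
     - lam \<bullet> column i (Amat M) - mu \<bullet> column i (Cmat M)"

definition cut_on_support ::
    "('n::finite,'m1::finite,'m2::finite) miqp \<Rightarrow> real^'n \<Rightarrow> real^'n
      \<Rightarrow> real^'n \<Rightarrow> real^'m2 \<Rightarrow> real^'n \<Rightarrow> bool" where
  "cut_on_support M \<delta> x y mu \<tau> \<longleftrightarrow>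
     (\<forall>i\<in>pos_supp x.
        \<tau> $ i = - \<delta> $ i * (y $ i)\<^sup>2 / (x $ i)\<^sup>2 - mu \<bullet> column i (Dmat M) + hvec M $ i)"

text \<open>Positivity of \<open>\<delta>\<close> outside \<open>S\<close> makes the quotients \<open>1 / \<delta>\<^sub>i\<close> meaningful.\<close>

definition perspective_cut ::
    "('n::finite,'m1::finite,'m2::finite) miqp \<Rightarrow> real^'n^'n \<Rightarrow> real^'n
      \<Rightarrow> real^'n \<Rightarrow> real^'n \<Rightarrow> bool" where
  "perspective_cut M R \<delta> x \<tau> \<longleftrightarrow>
     (\<forall>i\<in>- pos_supp x. \<delta> $ i > 0) \<and>
     (\<exists>y lam mu. sub_primal_dual M R \<delta> x y lam mu \<and> cut_on_support M \<delta> x y mu \<tau> \<and>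
       (\<forall>i\<in>- pos_supp x.
          let \<Psi> = 1 / \<delta> $ i * cut_residual M R x y lam mu i
          in \<tau> $ i = - \<delta> $ i / 4 * \<Psi>\<^sup>2 - mu \<bullet> column i (Dmat M) + hvec M $ i))"

definition col_zeros :: "real^'k^'n \<Rightarrow> real^'n \<Rightarrow> 'k set" where
  "col_zeros L x = {k. (\<Sum>l | L $ l $ k \<noteq> 0. x $ l) = 0}"

definition col_nnz :: "real^'k^'n \<Rightarrow> 'k \<Rightarrow> nat" where
  "col_nnz L k = card {j. L $ j $ k \<noteq> 0}"

text \<open>A zero column \<open>k\<close> of \<open>L\<close> belongs to \<^term>\<open>col_zeros L x\<close>; as \<open>1 / 0 = 0\<close>, it contributes
  nothing below.\<close>

definition rank_one_lhs ::
    "real^'n \<Rightarrow> real^'k^'n \<Rightarrow> real^'n \<Rightarrow> real^'n \<Rightarrow> 'n \<Rightarrow> real" where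
  "rank_one_lhs \<delta> L x \<beta> i =
     \<delta> $ i * \<beta> $ i
     + (\<Sum>k\<in>col_zeros L x.
          1 / real (col_nnz L k) * L $ i $ k * (\<Sum>j\<in>- pos_supp x. L $ j $ k * \<beta> $ j))"

definition perspective_rank_one_cut ::
    "('n::finite,'m1::finite,'m2::finite) miqp \<Rightarrow> real^'n^'n \<Rightarrow> real^'n
      \<Rightarrow> real^'k^'n \<Rightarrow> real^'n \<Rightarrow> real^'n \<Rightarrow> bool" where
  "perspective_rank_one_cut M R \<delta> L x \<tau> \<longleftrightarrow>
     (\<exists>y lam mu \<beta>. sub_primal_dual M R \<delta> x y lam mu \<and> cut_on_support M \<delta> x y mu \<tau> \<and>
       (\<forall>i\<in>- pos_supp x. rank_one_lhs \<delta> L x \<beta> i = 2 * cut_residual M R x y lam mu i) \<and>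
       (let \<psi> = (\<lambda>k. 1 / (2 * real (col_nnz L k)) * (\<Sum>j\<in>- pos_supp x. L $ j $ k * \<beta> $ j))
        in \<forall>i\<in>- pos_supp x.
          let \<Psi> = 1 / 2 * \<beta> $ i
          in \<tau> $ i = - \<delta> $ i / 4 * \<Psi>\<^sup>2
                     - 1 / 4 * (\<Sum>k | k \<in> col_zeros L x \<and> L $ i $ k \<noteq> 0. (\<psi> k)\<^sup>2)
                     - mu \<bullet> column i (Dmat M) + hvec M $ i))"

datatype cut_proc = Perspective | Perspective_Rank_One

fun is_cut ::
    "('n::finite,'m1::finite,'m2::finite) miqp \<Rightarrow> real^'n^'n \<Rightarrow> real^'n
      \<Rightarrow> real^'k^'n \<Rightarrow> cut_proc \<Rightarrow> real^'n \<Rightarrow> real^'n \<Rightarrow> bool" where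
  "is_cut M R \<delta> L Perspective x \<tau> = perspective_cut M R \<delta> x \<tau>"
| "is_cut M R \<delta> L Perspective_Rank_One x \<tau> = perspective_rank_one_cut M R \<delta> L x \<tau>"

text \<open>The formulas of a procedure are meaningful at \<open>x\<close>: no division by zero, respectively
  a nonsingular linear system.\<close>

fun proc_defined :: "real^'n \<Rightarrow> real^'k^'n \<Rightarrow> cut_proc \<Rightarrow> real^'n \<Rightarrow> bool" where
  "proc_defined \<delta> L Perspective x = (\<forall>i\<in>- pos_supp x. \<delta> $ i > 0)"
| "proc_defined \<delta> L Perspective_Rank_One x =
     (\<forall>\<beta>. (\<forall>i\<in>- pos_supp x. rank_one_lhs \<delta> L x \<beta> i = 0) \<longrightarrow> (\<forall>i\<in>- pos_supp x. \<beta> $ i = 0))"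

text \<open>Iterations are numbered from 1; entry 0 of the sequences below is never read.\<close>

definition oa_init ::
    "('n::finite,'m1::finite,'m2::finite) miqp \<Rightarrow> real^'n^'n \<Rightarrow> real^'n
      \<Rightarrow> ((real^'n) \<times> (real^'n) \<times> real) set" where
  "oa_init M R \<delta> =
     {(x, y, \<eta>). Amat M *v y \<le> bvec M \<and> Cmat M *v y \<le> Dmat M *v x \<and>
                 x \<in> convex hull Xset M \<and> ereal \<eta> \<ge> eta_persp M R \<delta>}"

definition oa_halfspace ::
    "('n::finite,'m1::finite,'m2::finite) miqp \<Rightarrow> real^'n^'n \<Rightarrow> real^'n
      \<Rightarrow> real^'n \<Rightarrow> real^'n \<Rightarrow> ((real^'n) \<times> (real^'n) \<times> real) set" where
  "oa_halfspace M R \<delta> xt \<tau> =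
     {(x, y, \<eta>). ereal \<eta> \<ge> ereal (\<tau> \<bullet> (x - xt)) + fbar_persp M R \<delta> xt}"

definition oa_region ::
    "('n::finite,'m1::finite,'m2::finite) miqp \<Rightarrow> real^'n^'n \<Rightarrow> real^'n
      \<Rightarrow> (nat \<Rightarrow> real^'n) \<Rightarrow> (nat \<Rightarrow> real^'n) \<Rightarrow> nat \<Rightarrow> ((real^'n) \<times> (real^'n) \<times> real) set" where
  "oa_region M R \<delta> x \<tau> t =
     oa_init M R \<delta> \<inter> (\<Inter>s\<in>{1..<t}. oa_halfspace M R \<delta> (x s) (\<tau> s))"

definition master_solution ::
    "('n::finite,'m1::finite,'m2::finite) miqp \<Rightarrow> ((real^'n) \<times> (real^'n) \<times> real) set
      \<Rightarrow> real^'n \<Rightarrow> real \<Rightarrow> bool" where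
  "master_solution M Z x \<eta> \<longleftrightarrow>
     x \<in> Xset M \<and> (\<exists>y. (x, y, \<eta>) \<in> Z) \<and>
     (\<forall>x' y' \<eta>'. x' \<in> Xset M \<and> (x', y', \<eta>') \<in> Z \<longrightarrow> \<eta> \<le> \<eta>')"

definition oa_stops ::
    "('n::finite,'m1::finite,'m2::finite) miqp \<Rightarrow> real^'n^'n \<Rightarrow> real^'n
      \<Rightarrow> real^'n \<Rightarrow> real \<Rightarrow> bool" where
  "oa_stops M R \<delta> x \<eta> \<longleftrightarrow> ereal \<eta> \<ge> fbar_persp M R \<delta> x"

text \<open>\<open>P\<close> is the set of procedures that may be used to generate cuts.\<close>

definition oa_iteration ::
    "('n::finite,'m1::finite,'m2::finite) miqp \<Rightarrow> real^'n^'n \<Rightarrow> real^'n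
      \<Rightarrow> real^'k^'n \<Rightarrow> cut_proc set
      \<Rightarrow> (nat \<Rightarrow> real^'n) \<Rightarrow> (nat \<Rightarrow> real) \<Rightarrow> (nat \<Rightarrow> real^'n) \<Rightarrow> nat \<Rightarrow> bool" where
  "oa_iteration M R \<delta> L P x \<eta> \<tau> t \<longleftrightarrow>
     master_solution M (oa_region M R \<delta> x \<tau> t) (x t) (\<eta> t) \<and>
     (\<not> oa_stops M R \<delta> (x t) (\<eta> t) \<longrightarrow> (\<exists>p\<in>P. is_cut M R \<delta> L p (x t) (\<tau> t)))"

text \<open>An execution follows the algorithm up to and including the first iteration at which it
  stops; later entries of the sequences are unconstrained.\<close>

definition oa_execution ::
    "('n::finite,'m1::finite,'m2::finite) miqp \<Rightarrow> real^'n^'n \<Rightarrow> real^'n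
      \<Rightarrow> real^'k^'n \<Rightarrow> cut_proc set
      \<Rightarrow> (nat \<Rightarrow> real^'n) \<Rightarrow> (nat \<Rightarrow> real) \<Rightarrow> (nat \<Rightarrow> real^'n) \<Rightarrow> bool" where
  "oa_execution M R \<delta> L P x \<eta> \<tau> \<longleftrightarrow>
     (\<forall>t\<ge>1. (\<forall>s\<in>{1..<t}. \<not> oa_stops M R \<delta> (x s) (\<eta> s)) \<longrightarrow> oa_iteration M R \<delta> L P x \<eta> \<tau> t)"

definition oa_unstopped ::
    "('n::finite,'m1::finite,'m2::finite) miqp \<Rightarrow> real^'n^'n \<Rightarrow> real^'n
      \<Rightarrow> real^'k^'n \<Rightarrow> cut_proc set
      \<Rightarrow> (nat \<Rightarrow> real^'n) \<Rightarrow> (nat \<Rightarrow> real) \<Rightarrow> (nat \<Rightarrow> real^'n) \<Rightarrow> nat \<Rightarrow> bool" where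
  "oa_unstopped M R \<delta> L P x \<eta> \<tau> T \<longleftrightarrow>
     (\<forall>t\<in>{1..T}. oa_iteration M R \<delta> L P x \<eta> \<tau> t \<and> \<not> oa_stops M R \<delta> (x t) (\<eta> t))"

end

theory Submission
  imports Defs
begin

text \<open>
  For binary \<open>x\<close> the perspective function restricts to the objective of the quadratic program, so
  the optimal value is the minimum of \<^const>\<open>fbar_persp\<close> over the finite set \<open>X\<close>. A cut generated
  at \<open>w\<close> is tight at \<open>w\<close>; hence no unstopped iterate is visited twice and the algorithm terminates.
  A cut never exceeds the objective at feasible binary points: add the constraints, weighted with
  their multipliers, to the objective, linearise \<open>y\<^sup>T R y\<close> at the minimiser for \<open>w\<close>, and bound what is
  left by inequalities of the form \<open>s\<^sup>2 \<ge> c s - c\<^sup>2 / 4 \<cdot> u\<close>, valid when \<open>u \<ge> 1\<close> or \<open>u = s = 0\<close>. The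
  quantity \<open>s\<close> is a coordinate \<open>z\<^sub>i\<close> with \<open>u = x\<^sub>i\<close>, or a rank-one term \<open>L\<^sub>k\<^sup>T z\<close> with \<open>u\<close> the sum of \<open>x\<close>
  over the support of \<open>L\<^sub>k\<close>; the cut procedures choose \<open>c\<close> to cancel the linear terms in \<open>z\<close>.
  So every master value is a lower bound, and the stopping test makes it an upper bound. Multipliers
  exist by Farkas' lemma, a consequence of the closedness of finitely generated cones.
\<close>

section \<open>Farkas' lemma and multipliers for quadratic minimisation\<close>

text \<open>A finitely generated cone is closed, so a point \<open>c\<close> outside the cone of the
  \<open>a k\<close> is strictly separated from it; the negated normal of the separating hyperplane
  is then a direction that violates \<open>sep\<close>.\<close>

lemma farkas:
  fixes a :: "'i \<Rightarrow> 'a::euclidean_space" and c :: 'a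
  assumes "finite I" and sep: "\<And>d. (\<forall>k\<in>I. a k \<bullet> d \<le> 0) \<Longrightarrow> c \<bullet> d \<le> 0"
  shows "\<exists>u. (\<forall>k\<in>I. 0 \<le> u k) \<and> c = (\<Sum>k\<in>I. u k *\<^sub>R a k)"
proof -
  let ?H = "convex_cone hull (a ` I)"
  let ?K = "{z. \<exists>u. (\<forall>k\<in>I. 0 \<le> u k) \<and> z = (\<Sum>k\<in>I. u k *\<^sub>R a k)}"
  have "c \<in> ?H"
  proof (rule ccontr)
    assume "c \<notin> ?H"
    moreover have "closed ?H" "convex ?H"
      using \<open>finite I\<close> by (simp_all add: closed_convex_cone_hull convex_convex_cone_hull)
    ultimately obtain d \<beta> where d: "d \<bullet> c < \<beta>" "\<And>x. x \<in> ?H \<Longrightarrow> \<beta> < d \<bullet> x"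
      using separating_hyperplane_closed_point by metis
    have neg: "\<beta> < 0"
      using d(2)[OF convex_cone_hull_contains_0] by simp
    have "0 \<le> d \<bullet> x" if x: "x \<in> ?H" for x
    proof (rule ccontr)
      assume "\<not> 0 \<le> d \<bullet> x"
      \<comment> \<open>The factor \<open>\<beta> / (d \<bullet> x)\<close> is nonnegative, so the
        scaled point stays in the cone, yet \<open>d\<close> takes there exactly the value
        \<open>\<beta>\<close> that it should strictly exceed.\<close>
      moreover have "\<beta> < d \<bullet> ((\<beta> / (d \<bullet> x)) *\<^sub>R x)" if "d \<bullet> x < 0"
        using that neg by (intro d(2) convex_cone_hull_mul x) (simp add: zero_le_divide_iff)
      ultimately show False
        by simp
    qed
    then have "\<forall>k\<in>I. a k \<bullet> (- d) \<le> 0"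
      by (simp add: hull_inc inner_commute[of _ d])
    from sep[OF this] show False
      using d(1) neg by (simp add: inner_commute)
  qed
  moreover have "?H \<subseteq> ?K"
  proof (rule hull_minimal)
    show "a ` I \<subseteq> ?K"
    proof clarify
      fix k assume "k \<in> I"
      have "a k = (\<Sum>j\<in>I. (if j = k then 1 else 0) *\<^sub>R a j)"
        using \<open>k \<in> I\<close> \<open>finite I\<close> by (simp add: if_distrib[of "\<lambda>r. r *\<^sub>R _"] sum.delta cong: if_cong)
      then show "\<exists>u. (\<forall>k\<in>I. 0 \<le> u k) \<and> a k = (\<Sum>k\<in>I. u k *\<^sub>R a k)"
        by (intro exI[of _ "\<lambda>j. if j = k then 1 else 0"]) simp
    qed
    show "convex_cone ?K"
      unfolding convex_cone_iff
    proof (intro conjI ballI allI impI)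
      show "0 \<in> ?K"
        by (auto intro!: exI[of _ "\<lambda>_. 0"])
    next
      fix x y assume "x \<in> ?K" "y \<in> ?K"
      then obtain u v where "\<forall>k\<in>I. 0 \<le> u k" "x = (\<Sum>k\<in>I. u k *\<^sub>R a k)"
        "\<forall>k\<in>I. 0 \<le> v k" "y = (\<Sum>k\<in>I. v k *\<^sub>R a k)"
        by auto
      then show "x + y \<in> ?K"
        by (auto intro!: exI[of _ "\<lambda>k. u k + v k"] simp: scaleR_add_left sum.distrib)
    next
      fix x and r :: real assume "x \<in> ?K" "0 \<le> r"
      then obtain u where "\<forall>k\<in>I. 0 \<le> u k" "x = (\<Sum>k\<in>I. u k *\<^sub>R a k)"
        by auto
      with \<open>0 \<le> r\<close> show "r *\<^sub>R x \<in> ?K"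
        by (auto intro!: exI[of _ "\<lambda>k. r * u k"] simp: scaleR_sum_right)
    qed
  qed
  ultimately show ?thesis
    by blast
qed

text \<open>The hypothesis \<open>expand\<close> makes \<open>G\<close> the gradient of
  \<open>f\<close> at \<open>y\<close>. If a direction increased no active constraint but had
  \<open>G \<bullet> d < 0\<close>, a short step along it would lower \<open>f\<close> and stay
  feasible, since inactive constraints have slack. Farkas' lemma on the active constraints then
  represents \<open>- G\<close>.\<close>

lemma quadratic_kkt:
  fixes a :: "'i \<Rightarrow> 'a::euclidean_space" and f q :: "'a \<Rightarrow> real"
  assumes "finite I" and feas: "\<And>k. k \<in> I \<Longrightarrow> a k \<bullet> y \<le> b k"
    and min: "\<And>z. (\<forall>k\<in>I. a k \<bullet> z \<le> b k) \<Longrightarrow> f y \<le> f z"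
    and expand: "\<And>t d. f (y + t *\<^sub>R d) = f y + t * (G \<bullet> d) + t\<^sup>2 * q d"
  shows "\<exists>u. (\<forall>k\<in>I. 0 \<le> u k) \<and> (\<forall>k\<in>I. u k * (a k \<bullet> y - b k) = 0)
             \<and> G + (\<Sum>k\<in>I. u k *\<^sub>R a k) = 0"
proof -
  let ?J = "{k\<in>I. a k \<bullet> y = b k}"
  have "- G \<bullet> d \<le> 0" if d: "\<forall>k\<in>?J. a k \<bullet> d \<le> 0" for d
  proof (rule ccontr)
    assume "\<not> - G \<bullet> d \<le> 0"
    then have neg: "G \<bullet> d + 0 * q d < 0" by simp
    have "((\<lambda>t. G \<bullet> d + t * q d) \<longlongrightarrow> G \<bullet> d + 0 * q d) (at_right 0)"
      by (intro tendsto_intros)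
    from order_tendstoD(2)[OF this neg]
    have ev1: "\<forall>\<^sub>F t in at_right 0. G \<bullet> d + t * q d < 0" .
    have "\<forall>\<^sub>F t in at_right 0. a k \<bullet> (y + t *\<^sub>R d) \<le> b k" if "k \<in> I" for k
    proof (cases "a k \<bullet> y = b k")
      case True
      then show ?thesis
        using d that
        by (auto simp: eventually_at_right_field inner_add_right mult_nonneg_nonpos intro!: exI[of _ 1])
    next
      case False
      then have lt: "a k \<bullet> (y + 0 *\<^sub>R d) < b k"
        using feas[OF that] by simp
      have "((\<lambda>t. a k \<bullet> (y + t *\<^sub>R d)) \<longlongrightarrow> a k \<bullet> (y + 0 *\<^sub>R d)) (at_right 0)"
        by (intro tendsto_intros)
      from order_tendstoD(2)[OF this lt] show ?thesis
        by eventually_elim simp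
    qed
    then have "\<forall>\<^sub>F t in at_right 0. \<forall>k\<in>I. a k \<bullet> (y + t *\<^sub>R d) \<le> b k"
      using \<open>finite I\<close> by (simp add: eventually_ball_finite_distrib)
    with ev1 have "\<forall>\<^sub>F t in at_right (0::real). False"
      using eventually_at_right_less[of 0]
    proof eventually_elim
      case (elim t)
      then have "0 \<le> t * (G \<bullet> d + t * q d)"
        using min[of "y + t *\<^sub>R d"] expand[of t d] by (simp add: algebra_simps power2_eq_square)
      with elim show False
        by (simp add: zero_le_mult_iff)
    qed
    then show False
      by simp
  qed
  from farkas[OF _ this, of ?J] \<open>finite I\<close> obtain u
    where u: "\<forall>k\<in>?J. 0 \<le> u k" "- G = (\<Sum>k\<in>?J. u k *\<^sub>R a k)"
    by auto
  \<comment> \<open>Extension by zero to the inactive constraints is what yields complementary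
    slackness.\<close>
  let ?u = "\<lambda>k. if k \<in> ?J then u k else 0"
  have "(\<Sum>k\<in>I. ?u k *\<^sub>R a k) = - G"
    unfolding u(2) using \<open>finite I\<close> by (intro sum.mono_neutral_cong_right) auto
  with u(1) show ?thesis
    by (intro exI[of _ ?u]) auto
qed

section \<open>Minimisation of positive definite quadratics\<close>

text \<open>The constant is the minimum of the form on the compact unit sphere, positive because it
  is attained at a nonzero vector; homogeneity of degree two carries the bound to all
  vectors.\<close>

lemma pos_def_coercive:
  fixes Q :: "real^'n^'n"
  assumes "pos_def Q"
  shows "\<exists>c>0. \<forall>v. c * (norm v)\<^sup>2 \<le> v \<bullet> (Q *v v)"
proof -
  have "continuous_on (sphere 0 1) (\<lambda>v. v \<bullet> (Q *v v))"
    by (intro continuous_intros)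
  moreover have "sphere (0::real^'n) 1 \<noteq> {}" "compact (sphere (0::real^'n) 1)"
    by simp_all
  ultimately obtain w where w: "norm w = 1" "\<And>v. norm v = 1 \<Longrightarrow> w \<bullet> (Q *v w) \<le> v \<bullet> (Q *v v)"
    using continuous_attains_inf[of "sphere 0 1" "\<lambda>v. v \<bullet> (Q *v v)"] by auto
  have "w \<bullet> (Q *v w) * (norm v)\<^sup>2 \<le> v \<bullet> (Q *v v)" for v
  proof (cases "v = 0")
    case False
    have "v = norm v *\<^sub>R (v /\<^sub>R norm v)"
      using False by simp
    then have "v \<bullet> (Q *v v) = (norm v)\<^sup>2 * ((v /\<^sub>R norm v) \<bullet> (Q *v (v /\<^sub>R norm v)))"
      using False by (simp add: matrix_vector_mult_scaleR power2_eq_square field_simps)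
    moreover have "w \<bullet> (Q *v w) \<le> (v /\<^sub>R norm v) \<bullet> (Q *v (v /\<^sub>R norm v))"
      using False by (intro w(2)) simp
    ultimately show ?thesis
      by (metis mult.commute mult_left_mono zero_le_power2)
  qed simp
  moreover have "0 < w \<bullet> (Q *v w)"
    using assms w(1) unfolding pos_def_def by (metis norm_zero zero_neq_one)
  ultimately show ?thesis
    by blast
qed

lemma pos_def_bounded_below:
  fixes Q :: "real^'n^'n" and g :: "real^'n"
  assumes "pos_def Q"
  shows "\<exists>B. \<forall>v. B \<le> v \<bullet> (Q *v v) + g \<bullet> v"
proof -
  obtain c where c: "c > 0" "\<And>v. c * (norm v)\<^sup>2 \<le> v \<bullet> (Q *v v)"
    using pos_def_coercive[OF assms] by blast
  \<comment> \<open>The bound is the minimum over real \<open>s\<close> of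
    \<open>c * s^2 - norm g * s\<close>, found by completing the square.\<close>
  have "- (norm g)\<^sup>2 / (4 * c) \<le> v \<bullet> (Q *v v) + g \<bullet> v" for v
  proof -
    have "0 \<le> (2 * c * norm v - norm g)\<^sup>2 / (4 * c)"
      using c(1) by simp
    also have "\<dots> = c * (norm v)\<^sup>2 - norm g * norm v + (norm g)\<^sup>2 / (4 * c)"
      using c(1) by (simp add: field_simps power2_eq_square)
    finally show ?thesis
      using c(2)[of v] Cauchy_Schwarz_ineq2[of g v] by (simp add: abs_le_iff)
  qed
  then show ?thesis
    by blast
qed

text \<open>By coercivity the part of \<open>F\<close> in the sublevel set of any of its points is
  compact, and a minimiser there is a minimiser on all of \<open>F\<close>.\<close>

lemma pos_def_attains_min:
  fixes Q :: "real^'n^'n" and g :: "real^'n"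
  assumes "pos_def Q" "closed F" "F \<noteq> {}"
  shows "\<exists>y\<in>F. \<forall>z\<in>F. y \<bullet> (Q *v y) + g \<bullet> y \<le> z \<bullet> (Q *v z) + g \<bullet> z"
proof -
  let ?f = "\<lambda>v. v \<bullet> (Q *v v) + g \<bullet> v"
  obtain c where c: "c > 0" "\<And>v. c * (norm v)\<^sup>2 \<le> v \<bullet> (Q *v v)"
    using pos_def_coercive[OF assms(1)] by blast
  obtain v0 where v0: "v0 \<in> F"
    using assms(3) by blast
  have cont: "continuous_on UNIV ?f"
    by (intro continuous_intros)
  let ?B = "F \<inter> {v. ?f v \<le> ?f v0}"
  define r where "r = ?f v0"
  \<comment> \<open>Beyond this radius the quadratic term exceeds
    \<open>(norm g + \<bar>r\<bar>) * norm v\<close>. The summand 1 ensures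
    \<open>norm v > 1\<close>, so that \<open>\<bar>r\<bar> * norm v\<close> dominates
    \<open>\<bar>r\<bar>\<close>.\<close>
  have "norm v \<le> (norm g + \<bar>r\<bar>) / c + 1" if le: "?f v \<le> r" for v
  proof (rule ccontr)
    assume "\<not> ?thesis"
    then have gt: "(norm g + \<bar>r\<bar>) / c + 1 < norm v" by simp
    have "0 \<le> (norm g + \<bar>r\<bar>) / c"
      using c(1) by simp
    with gt have one: "1 < norm v"
      by linarith
    have "(norm g + \<bar>r\<bar>) / c < norm v"
      using gt by simp
    then have "norm g + \<bar>r\<bar> < c * norm v"
      using c(1) by (simp add: divide_less_eq mult.commute)
    then have "(norm g + \<bar>r\<bar>) * norm v < (c * norm v) * norm v"
      by (rule mult_strict_right_mono) (use one in linarith)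
    moreover have "\<bar>r\<bar> * 1 \<le> \<bar>r\<bar> * norm v"
      using one by (intro mult_left_mono) auto
    moreover have "- (norm g * norm v) \<le> g \<bullet> v"
      using Cauchy_Schwarz_ineq2[of g v] by (simp add: abs_le_iff)
    ultimately show False
      using le c(2)[of v] by (simp add: distrib_right power2_eq_square)
  qed
  then have "bounded ?B"
    by (intro boundedI[where B = "(norm g + \<bar>r\<bar>) / c + 1"]) (simp add: r_def)
  moreover have "closed {v. ?f v \<le> ?f v0}"
    by (rule closed_Collect_le[OF cont continuous_on_const])
  then have "closed ?B"
    by (rule closed_Int[OF assms(2)])
  ultimately have compact: "compact ?B"
    by (simp only: compact_eq_bounded_closed simp_thms)
  have nonempty: "?B \<noteq> {}"
    using v0 by auto
  have "continuous_on ?B ?f"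
    by (rule continuous_on_subset[OF cont subset_UNIV])
  from continuous_attains_inf[OF compact nonempty this]
  obtain y where y: "y \<in> ?B" "\<forall>z\<in>?B. ?f y \<le> ?f z"
    by (elim bexE)
  have "?f y \<le> ?f z" if "z \<in> F" for z
    using y that by (cases "?f z \<le> ?f v0") auto
  moreover have "y \<in> F"
    using y(1) by (rule IntD1)
  ultimately show ?thesis
    by (intro bexI ballI)
qed

section \<open>Matrix identities and binary vectors\<close>

lemma matrix_vector_mult_columns:
  fixes H :: "real^'n^'m"
  shows "H *v z = (\<Sum>i\<in>UNIV. z $ i *\<^sub>R column i H)"
  by (simp add: matrix_mult_sum scalar_mult_eq_scaleR)

lemma inner_matrix_vector_columns:
  fixes H :: "real^'n^'m"
  shows "l \<bullet> (H *v z) = (\<Sum>i\<in>UNIV. (l \<bullet> column i H) * z $ i)"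
  by (simp add: matrix_vector_mult_columns inner_sum_right mult.commute)

lemma inner_symmetric_matrix:
  fixes Q :: "real^'n^'n"
  assumes "transpose Q = Q"
  shows "u \<bullet> (Q *v v) = v \<bullet> (Q *v u)"
  by (metis assms dot_lmul_matrix inner_commute vector_transpose_matrix)

lemma quadratic_form_add:
  fixes Q :: "real^'n^'n"
  assumes "transpose Q = Q"
  shows "(u + v) \<bullet> (Q *v (u + v)) = u \<bullet> (Q *v u) + 2 * (v \<bullet> (Q *v u)) + v \<bullet> (Q *v v)"
  using inner_symmetric_matrix[OF assms, of u v]
  by (simp add: algebra_simps inner_add_left inner_add_right)

lemma quadratic_form_diag_mat: "v \<bullet> (diag_mat d *v v) = (\<Sum>i\<in>UNIV. d $ i * (v $ i)\<^sup>2)"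
proof -
  have "(diag_mat d *v v) $ i = d $ i * v $ i" for i
    by (simp add: diag_mat_def matrix_vector_mult_def if_distrib[of "\<lambda>r. r * _"] cong: if_cong)
  then show ?thesis
    by (simp add: inner_vec_def power2_eq_square mult_ac)
qed

lemma finite_binary_vectors: "finite {x :: real^'n. \<forall>i. x $ i \<in> {0, 1}}"
proof -
  have "{x :: real^'n. \<forall>i. x $ i \<in> {0, 1}} \<subseteq> (\<lambda>f. \<chi> i. f i) ` (PiE UNIV (\<lambda>_. {0, 1}))"
  proof
    fix x :: "real^'n" assume "x \<in> {x. \<forall>i. x $ i \<in> {0, 1}}"
    then have "(\<lambda>i. x $ i) \<in> PiE UNIV (\<lambda>_. {0, 1})" "x = (\<chi> i. x $ i)"
      by (auto simp: PiE_def Pi_def)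
    then show "x \<in> (\<lambda>f. \<chi> i. f i) ` (PiE UNIV (\<lambda>_. {0, 1}))"
      by blast
  qed
  then show ?thesis
    by (rule finite_subset) (intro finite_imageI finite_PiE, auto)
qed

section \<open>Restriction to the support\<close>

definition miqp_obj ::
    "('n::finite, 'm1::finite, 'm2::finite) miqp \<Rightarrow> real^'n \<Rightarrow> real^'n \<Rightarrow> real" where
  "miqp_obj M x y = y \<bullet> (Qmat M *v y) + gvec M \<bullet> y + hvec M \<bullet> x"

text \<open>Zeroing coordinates without changing the type turns the sums over
  \<open>pos_supp\<close> in the subproblem into ordinary matrix and inner products.\<close>

definition restrict_vec :: "'n set \<Rightarrow> real^'n \<Rightarrow> real^'n" where
  "restrict_vec S v = (\<chi> i. if i \<in> S then v $ i else 0)"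

lemma restrict_vec_nth [simp]: "restrict_vec S v $ i = (if i \<in> S then v $ i else 0)"
  by (simp add: restrict_vec_def)

lemma restrict_vec_ident: "(\<And>i. i \<notin> S \<Longrightarrow> v $ i = 0) \<Longrightarrow> restrict_vec S v = v"
  by (simp add: vec_eq_iff)

lemma restrict_vec_add_scaleR:
  "restrict_vec S (u + t *\<^sub>R v) = restrict_vec S u + t *\<^sub>R restrict_vec S v"
  by (simp add: vec_eq_iff)

lemma inner_restrict_vec: "u \<bullet> restrict_vec S v = (\<Sum>i\<in>S. u $ i * v $ i)"
proof -
  have "u \<bullet> restrict_vec S v = (\<Sum>i\<in>UNIV. if i \<in> S then u $ i * v $ i else 0)"
    by (auto simp: inner_vec_def intro!: sum.cong)
  then show ?thesis
    by (simp add: sum.If_cases)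
qed

lemma restrict_vec_inner_commute: "restrict_vec S u \<bullet> v = u \<bullet> restrict_vec S v"
  by (simp add: inner_restrict_vec inner_commute[of "restrict_vec S u"] mult.commute)

lemma sub_lhs_restrict: "sub_lhs H x y = H *v restrict_vec (pos_supp x) y"
proof -
  have "H *v restrict_vec (pos_supp x) y
      = (\<Sum>i\<in>UNIV. if i \<in> pos_supp x then y $ i *\<^sub>R column i H else 0)"
    unfolding matrix_vector_mult_columns by (intro sum.cong) auto
  then show ?thesis
    by (simp add: sub_lhs_def sum.If_cases)
qed

lemma sum_row_restrict:
  "(\<Sum>j\<in>S. R $ i $ j * y $ j) = (R *v restrict_vec S y) $ i" for R :: "real^'n^'m"
proof -
  have "(R *v restrict_vec S y) $ i = (\<Sum>j\<in>UNIV. if j \<in> S then R $ i $ j * y $ j else 0)"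
    by (auto simp: matrix_vector_mult_def intro!: sum.cong)
  then show ?thesis
    by (simp add: sum.If_cases)
qed

section \<open>The perspective objective and the validity of cuts\<close>

text \<open>Dividing a square by a positive number at most 1 can only enlarge it; at
  \<open>x = 0\<close> the term is infinite unless \<open>y = 0\<close>.\<close>

lemma persp_term_ge:
  assumes "0 \<le> d" "0 \<le> x" "x \<le> 1"
  shows "ereal (d * y\<^sup>2) \<le> persp_term d y x"
proof (cases "x > 0")
  case True
  have "y\<^sup>2 \<le> y\<^sup>2 / x"
    using True assms(3) by (simp add: pos_le_divide_eq mult_left_le)
  from mult_left_mono[OF this assms(1)] show ?thesis
    using True by (simp add: persp_term_def persp_quot_def)
next
  case False
  then show ?thesis
    using assms by (auto simp: persp_term_def persp_quot_def)
qed

text \<open>This serves to bound the relaxation from below: points of the convex hull of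
  \<open>Xset M\<close> lie in the unit box.\<close>

lemma f_persp_ge:
  assumes dec: "Qmat M = R + diag_mat \<delta>" and "\<And>i. 0 \<le> \<delta> $ i"
    and "\<And>i. 0 \<le> x $ i" "\<And>i. x $ i \<le> 1"
  shows "ereal (miqp_obj M x y) \<le> f_persp M R \<delta> x y"
proof -
  have "(\<Sum>i\<in>UNIV. ereal (\<delta> $ i * (y $ i)\<^sup>2)) \<le> (\<Sum>i\<in>UNIV. persp_term (\<delta> $ i) (y $ i) (x $ i))"
    using assms by (intro sum_mono persp_term_ge) auto
  then have "ereal (y \<bullet> (R *v y)) + ereal (\<Sum>i\<in>UNIV. \<delta> $ i * (y $ i)\<^sup>2)
             + ereal (gvec M \<bullet> y) + ereal (hvec M \<bullet> x)
      \<le> ereal (y \<bullet> (R *v y)) + (\<Sum>i\<in>UNIV. persp_term (\<delta> $ i) (y $ i) (x $ i))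
             + ereal (gvec M \<bullet> y) + ereal (hvec M \<bullet> x)"
    unfolding sum_ereal by (intro add_mono order_refl)
  then show ?thesis
    by (simp add: f_persp_def miqp_obj_def dec matrix_vector_mult_add_rdistrib inner_add_right
        quadratic_form_diag_mat)
qed

text \<open>At \<open>x $ i = 1\<close> the quotient is the plain square; at
  \<open>x $ i = 0\<close> it is infinite unless \<open>y $ i = 0\<close>, which is exactly the
  complementarity constraint.\<close>

lemma f_persp_binary:
  assumes dec: "Qmat M = R + diag_mat \<delta>"
    and X: "x \<in> Xset M" and bin: "\<And>i. x $ i \<in> {0, 1}"
  shows "f_persp M R \<delta> x y = (if miqp_feasible M x y then ereal (miqp_obj M x y) else \<infinity>)"
proof (cases "miqp_feasible M x y")
  case True
  have "persp_term (\<delta> $ i) (y $ i) (x $ i) = ereal (\<delta> $ i * (y $ i)\<^sup>2)" for i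
    using bin[of i] True
    by (cases "x $ i = 0") (auto simp: miqp_feasible_def persp_term_def persp_quot_def dest: spec[of _ i])
  then show ?thesis
    using True
    by (simp add: f_persp_def miqp_obj_def dec matrix_vector_mult_add_rdistrib inner_add_right
        quadratic_form_diag_mat miqp_feasible_def)
next
  case False
  show ?thesis
  proof (cases "Amat M *v y \<le> bvec M \<and> Cmat M *v y \<le> Dmat M *v x")
    case True
    with False X obtain i where "y $ i * (1 - x $ i) \<noteq> 0"
      by (auto simp: miqp_feasible_def)
    then have "persp_term (\<delta> $ i) (y $ i) (x $ i) = \<infinity>"
      using bin[of i] by (auto simp: persp_term_def persp_quot_def)
    then have "(\<Sum>i\<in>UNIV. persp_term (\<delta> $ i) (y $ i) (x $ i)) = \<infinity>"
      by (auto simp: sum_Pinfty)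
    then show ?thesis
      using True False by (simp add: f_persp_def)
  qed (use False in \<open>auto simp: f_persp_def\<close>)
qed

text \<open>Perspective cuts are the case \<open>K = {}\<close>.\<close>

lemma cut_inequality:
  fixes M :: "('n::finite, 'm1::finite, 'm2::finite) miqp" and L :: "real^'k^'n"
  assumes bin: "\<And>x i. x \<in> Xset M \<Longrightarrow> x $ i \<in> {0, 1}"
    and dec: "Qmat M = R + diag_mat \<delta>" and \<delta>: "\<And>i. 0 \<le> \<delta> $ i"
    and sym: "transpose R = R"
    and K: "\<And>v. (\<Sum>k\<in>K. (\<Sum>i\<in>UNIV. L $ i $ k * v $ i)\<^sup>2) \<le> v \<bullet> (R *v v)"
    and K0: "\<And>k i. k \<in> K \<Longrightarrow> i \<in> pos_supp w \<Longrightarrow> L $ i $ k = 0"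
    and w: "w \<in> Xset M" and pd: "sub_primal_dual M R \<delta> w y lam mu"
    and \<tau>S: "cut_on_support M \<delta> w y mu \<tau>"
    and res: "\<And>i. i \<notin> pos_supp w \<Longrightarrow>
        \<delta> $ i * \<Psi> i + (\<Sum>k\<in>K. L $ i $ k * \<psi> k) = cut_residual M R w y lam mu i"
    and \<tau>C: "\<And>i. i \<notin> pos_supp w \<Longrightarrow>
        \<tau> $ i = - \<delta> $ i / 4 * (\<Psi> i)\<^sup>2 - 1 / 4 * (\<Sum>k | k \<in> K \<and> L $ i $ k \<noteq> 0. (\<psi> k)\<^sup>2)
                - mu \<bullet> column i (Dmat M) + hvec M $ i"
    and feas: "miqp_feasible M x z"
  shows "\<tau> \<bullet> (x - w) + miqp_obj M w y \<le> miqp_obj M x z"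
proof -
  let ?S = "pos_supp w"
  have wS: "w $ i = (if i \<in> ?S then 1 else 0)" for i
    using bin[OF w, of i] by (auto simp: pos_supp_def)
  have xbin: "x $ i \<in> {0, 1}" for i
    using bin feas by (auto simp: miqp_feasible_def)
  have x0: "x $ i = 0 \<Longrightarrow> z $ i = 0" for i
    using feas unfolding miqp_feasible_def by (metis diff_zero mult.right_neutral)
  have y0: "i \<notin> ?S \<Longrightarrow> y $ i = 0" for i
    using pd by (simp add: sub_primal_dual_def)
  have ry: "restrict_vec ?S y = y"
    using y0 by (rule restrict_vec_ident)
  \<comment> \<open>These are the coefficients of the function linear in \<open>z\<close> that
    remains when \<open>z \<bullet> (R *v z)\<close> is linearised at \<open>y\<close> and the
    constraints are added with their multipliers. The diagonal part is kept apart, so stationarity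
    leaves \<open>- 2 * \<delta> $ i * y $ i\<close> on the support and the negated residual off
    it.\<close>
  define a where "a i = 2 * (R *v y) $ i + gvec M $ i
      + lam \<bullet> column i (Amat M) + mu \<bullet> column i (Cmat M)" for i
  have aS: "a i = - 2 * \<delta> $ i * y $ i" if "i \<in> ?S" for i
  proof -
    have "2 * (\<Sum>j\<in>?S. R $ i $ j * y $ j) + 2 * (\<delta> $ i / w $ i) * y $ i + gvec M $ i
        + lam \<bullet> column i (Amat M) + mu \<bullet> column i (Cmat M) = 0"
      using pd that unfolding sub_primal_dual_def by blast
    then show ?thesis
      using that wS[of i] by (simp add: a_def sum_row_restrict ry)
  qed
  have aC: "a i = - (\<delta> $ i * \<Psi> i + (\<Sum>k\<in>K. L $ i $ k * \<psi> k))" if "i \<notin> ?S" for i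
    using res[OF that] by (simp add: a_def cut_residual_def sum_row_restrict ry)
  have a_inner: "(\<Sum>i\<in>UNIV. a i * v $ i)
      = 2 * (v \<bullet> (R *v y)) + gvec M \<bullet> v + lam \<bullet> (Amat M *v v) + mu \<bullet> (Cmat M *v v)" for v
    unfolding a_def inner_matrix_vector_columns[of lam] inner_matrix_vector_columns[of mu]
    by (simp add: inner_vec_def[of v] inner_vec_def[of "gvec M"] sum.distrib sum_distrib_left
        distrib_left mult_ac)
  have obj: "miqp_obj M u v = v \<bullet> (R *v v) + (\<Sum>i\<in>UNIV. \<delta> $ i * (v $ i)\<^sup>2) + gvec M \<bullet> v + hvec M \<bullet> u"
    for u v
    by (simp add: miqp_obj_def dec matrix_vector_mult_add_rdistrib inner_add_right
        quadratic_form_diag_mat)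
  have slackA: "lam \<bullet> (Amat M *v y) = lam \<bullet> bvec M"
  proof -
    have "\<forall>k. lam $ k * (sub_lhs (Amat M) w y - bvec M) $ k = 0"
      using pd unfolding sub_primal_dual_def by blast
    then have "lam \<bullet> (Amat M *v y - bvec M) = 0"
      unfolding inner_vec_def sub_lhs_restrict ry by (simp only: inner_real_def sum.neutral_const)
    then show ?thesis by (simp add: inner_diff_right)
  qed
  have slackC: "mu \<bullet> (Cmat M *v y) = mu \<bullet> (Dmat M *v w)"
  proof -
    have "\<forall>k. mu $ k * (sub_lhs (Cmat M) w y - Dmat M *v w) $ k = 0"
      using pd unfolding sub_primal_dual_def by blast
    then have "mu \<bullet> (Cmat M *v y - Dmat M *v w) = 0"
      unfolding inner_vec_def sub_lhs_restrict ry by (simp only: inner_real_def sum.neutral_const)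
    then show ?thesis by (simp add: inner_diff_right)
  qed
  have dualA: "lam \<bullet> (Amat M *v z) \<le> lam \<bullet> bvec M"
    and dualC: "mu \<bullet> (Cmat M *v z) \<le> mu \<bullet> (Dmat M *v x)"
  proof -
    have "0 \<le> lam" "0 \<le> mu"
      using pd unfolding sub_primal_dual_def by blast+
    then show "lam \<bullet> (Amat M *v z) \<le> lam \<bullet> bvec M" "mu \<bullet> (Cmat M *v z) \<le> mu \<bullet> (Dmat M *v x)"
      using feas by (auto simp: miqp_feasible_def inner_vec_def less_eq_vec_def
        intro!: sum_mono mult_left_mono)
  qed

  \<comment> \<open>Evaluating the linear function at \<open>y\<close> itself, with complementary
    slackness, sums the stationarity conditions over the support.\<close>
  have "(\<Sum>i\<in>UNIV. a i * y $ i) = (\<Sum>i\<in>UNIV. - 2 * (\<delta> $ i * (y $ i)\<^sup>2))"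
  proof (intro sum.cong refl)
    show "a i * y $ i = - 2 * (\<delta> $ i * (y $ i)\<^sup>2)" for i
      by (cases "i \<in> ?S") (simp_all add: aS y0 power2_eq_square)
  qed
  then have y_stat: "2 * (y \<bullet> (R *v y)) + gvec M \<bullet> y + lam \<bullet> bvec M + mu \<bullet> (Dmat M *v w)
      = - 2 * (\<Sum>i\<in>UNIV. \<delta> $ i * (y $ i)\<^sup>2)"
    unfolding a_inner slackA slackC by (simp add: sum_distrib_left)
  \<comment> \<open>Since \<open>w\<close> vanishes off the support, only the coordinates given by
    \<open>cut_on_support\<close> enter, and the constant term of the cut becomes explicit.\<close>
  have "\<tau> \<bullet> w = (\<Sum>i\<in>UNIV. - (\<delta> $ i * (y $ i)\<^sup>2) - (mu \<bullet> column i (Dmat M)) * w $ i + hvec M $ i * w $ i)"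
    unfolding inner_vec_def[of \<tau>]
  proof (intro sum.cong refl)
    show "\<tau> $ i \<bullet> w $ i
        = - (\<delta> $ i * (y $ i)\<^sup>2) - (mu \<bullet> column i (Dmat M)) * w $ i + hvec M $ i * w $ i" for i
      using \<tau>S wS[of i] by (cases "i \<in> ?S") (simp_all add: cut_on_support_def y0)
  qed
  also have "\<dots> = - (\<Sum>i\<in>UNIV. \<delta> $ i * (y $ i)\<^sup>2) - mu \<bullet> (Dmat M *v w) + hvec M \<bullet> w"
    by (simp add: sum.distrib sum_subtractf sum_negf inner_matrix_vector_columns[of mu]
        inner_vec_def[of "hvec M"])
  finally have \<tau>w: "miqp_obj M w y - \<tau> \<bullet> w = - (y \<bullet> (R *v y)) - lam \<bullet> bvec M"
    using y_stat obj[of w y] by simp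

  let ?l = "\<lambda>k v. \<Sum>i\<in>UNIV. L $ i $ k * v $ i"
  let ?X = "\<lambda>k. \<Sum>i | L $ i $ k \<noteq> 0. x $ i"
  \<comment> \<open>This is the share of coordinate \<open>i\<close> in the sum over
    \<open>k\<close> of \<open>(\<psi> k)^2 * ?X k / 4 - \<psi> k * ?l k z\<close>. It splits the
    rank-one inequalities over coordinates, so that they can be compared with the entries of
    \<open>\<tau>\<close>.\<close>
  let ?c = "\<lambda>i. \<Sum>k\<in>K. (if L $ i $ k = 0 then 0 else (\<psi> k)\<^sup>2 * x $ i) / 4 - \<psi> k * (L $ i $ k * z $ i)"
  have rank: "(\<Sum>k\<in>K. (?l k z)\<^sup>2) \<le> (z - y) \<bullet> (R *v (z - y))"
  proof -
    \<comment> \<open>The column \<open>k\<close> vanishes on the support of \<open>w\<close> and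
      \<open>y\<close> vanishes off it, so the two are orthogonal.\<close>
    have "?l k (z - y) = ?l k z" if "k \<in> K" for k
    proof (intro sum.cong refl)
      show "L $ i $ k * (z - y) $ i = L $ i $ k * z $ i" for i
        using K0[OF that, of i] y0[of i] by (cases "i \<in> ?S") auto
    qed
    then show ?thesis
      using K[of "z - y"] by simp
  qed
  \<comment> \<open>The last summand, the remainder of the linearisation, is kept: by
    \<open>rank\<close> it pays for the rank-one terms.\<close>
  have zRz: "z \<bullet> (R *v z) = y \<bullet> (R *v y) + 2 * ((z - y) \<bullet> (R *v y)) + (z - y) \<bullet> (R *v (z - y))"
    using quadratic_form_add[OF sym, of y "z - y"] by simp

  have nonneg: "0 \<le> (\<Sum>k\<in>K. (?l k z)\<^sup>2) + (\<Sum>i\<in>UNIV. ?c i)"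
  proof -
    have "(\<Sum>i\<in>UNIV. ?c i) = (\<Sum>k\<in>K. (\<psi> k)\<^sup>2 * ?X k / 4 - \<psi> k * ?l k z)"
    proof (subst sum.swap, intro sum.cong refl)
      fix k
      have "(\<Sum>i\<in>UNIV. (if L $ i $ k = 0 then 0 else (\<psi> k)\<^sup>2 * x $ i) / 4)
          = (\<Sum>i | L $ i $ k \<noteq> 0. (\<psi> k)\<^sup>2 * x $ i / 4)"
        by (intro sum.mono_neutral_cong_right) auto
      then show "(\<Sum>i\<in>UNIV. (if L $ i $ k = 0 then 0 else (\<psi> k)\<^sup>2 * x $ i) / 4 - \<psi> k * (L $ i $ k * z $ i))
          = (\<psi> k)\<^sup>2 * ?X k / 4 - \<psi> k * ?l k z"
        by (simp add: sum_subtractf sum_distrib_left sum_divide_distrib)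
    qed
    \<comment> \<open>Either \<open>x\<close> is 1 somewhere on the support of the column, so
      \<open>?X k \<ge> 1\<close> and completing the square suffices, or \<open>x\<close>, and with
      it \<open>z\<close>, vanishes there and every term is zero.\<close>
    moreover have "0 \<le> (?l k z)\<^sup>2 + ((\<psi> k)\<^sup>2 * ?X k / 4 - \<psi> k * ?l k z)" for k
    proof (cases "\<exists>i. L $ i $ k \<noteq> 0 \<and> x $ i \<noteq> 0")
      case True
      then obtain i where i: "L $ i $ k \<noteq> 0" "x $ i = 1"
        using xbin by blast
      have "x $ i \<le> ?X k"
      proof (rule member_le_sum)
        show "0 \<le> x $ j" for j
          using xbin[of j] by auto
      qed (use i in auto)
      with i have "1 \<le> ?X k" by simp
      then have "(\<psi> k)\<^sup>2 \<le> (\<psi> k)\<^sup>2 * ?X k"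
        by (simp add: mult_le_cancel_left1)
      moreover have "0 \<le> (?l k z - \<psi> k / 2)\<^sup>2"
        by simp
      ultimately show ?thesis
        by (simp add: power2_diff power_divide algebra_simps)
    next
      case False
      then have "?l k z = 0" "?X k = 0"
        using x0 by (auto intro!: sum.neutral)
      then show ?thesis by simp
    qed
    ultimately show ?thesis
      by (simp add: sum.distrib[symmetric] sum_nonneg)
  qed

  \<comment> \<open>Where \<open>x $ i = 0\<close> everything vanishes. Otherwise the inequality
    amounts to \<open>\<delta> $ i * (z $ i - y $ i)^2 \<ge> 0\<close> on the support and to the
    nonnegativity of \<open>\<delta> $ i * (z $ i - \<Psi> i / 2)^2\<close> off it.\<close>
  have index: "\<tau> $ i * x $ i + ?c i
      \<le> a i * z $ i + \<delta> $ i * (z $ i)\<^sup>2 + (hvec M $ i - mu \<bullet> column i (Dmat M)) * x $ i" for i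
  proof (cases "i \<in> ?S")
    case True
    have "?c i = 0"
      using K0[OF _ True] by (intro sum.neutral) auto
    moreover have "0 \<le> \<delta> $ i * (z $ i - y $ i)\<^sup>2"
      using \<delta> by simp
    ultimately show ?thesis
      using True \<tau>S wS[of i] xbin[of i] x0[of i] \<delta>[of i]
      by (auto simp: cut_on_support_def aS power2_diff algebra_simps power2_eq_square)
  next
    case False
    have "(\<Sum>k | k \<in> K \<and> L $ i $ k \<noteq> 0. (\<psi> k)\<^sup>2) = (\<Sum>k\<in>K. if L $ i $ k = 0 then 0 else (\<psi> k)\<^sup>2)"
      by (intro sum.mono_neutral_cong_left) auto
    note support = this
    have c: "?c i = (\<Sum>k | k \<in> K \<and> L $ i $ k \<noteq> 0. (\<psi> k)\<^sup>2) / 4 * x $ i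
        - (\<Sum>k\<in>K. L $ i $ k * \<psi> k) * z $ i"
      unfolding support sum_subtractf sum_divide_distrib sum_distrib_right
      by (intro arg_cong2[where f = "(-)"] sum.cong refl) auto
    have "0 \<le> \<delta> $ i * (z $ i - \<Psi> i / 2)\<^sup>2"
      using \<delta> by simp
    then have "0 \<le> \<delta> $ i * ((z $ i)\<^sup>2 - \<Psi> i * z $ i + (\<Psi> i)\<^sup>2 / 4 * x $ i)"
      using xbin[of i] x0[of i] by (auto simp: power2_diff power_divide algebra_simps)
    then show ?thesis
      unfolding c \<tau>C[OF False] aC[OF False] by (simp add: algebra_simps)
  qed
  have "\<tau> \<bullet> x + (\<Sum>i\<in>UNIV. ?c i)
      \<le> (\<Sum>i\<in>UNIV. a i * z $ i + \<delta> $ i * (z $ i)\<^sup>2 + (hvec M $ i - mu \<bullet> column i (Dmat M)) * x $ i)"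
    using sum_mono[where K = UNIV, OF index] by (simp add: inner_vec_def[of \<tau>] sum.distrib)
  also have "\<dots> = (\<Sum>i\<in>UNIV. a i * z $ i) + (\<Sum>i\<in>UNIV. \<delta> $ i * (z $ i)\<^sup>2) + hvec M \<bullet> x - mu \<bullet> (Dmat M *v x)"
    by (simp add: sum.distrib sum_subtractf inner_matrix_vector_columns[of mu]
        inner_vec_def[of "hvec M"] left_diff_distrib)
  \<comment> \<open>Weak duality replaces the multiplier terms at \<open>z\<close> by
    \<open>lam \<bullet> bvec M\<close>, which cancels against \<open>\<tau>w\<close>; the shares
    \<open>?c i\<close> are absorbed by the remainder of the linearisation.\<close>
  finally show ?thesis
    using nonneg rank zRz \<tau>w dualA dualC obj[of x z] a_inner[of z]
    by (simp add: inner_diff_right inner_diff_left)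
qed

section \<open>Existence of primal-dual solutions and of cuts\<close>

lemma sum_UNIV_Plus:
  "(\<Sum>k\<in>UNIV. f k) = (\<Sum>k\<in>UNIV. f (Inl k)) + (\<Sum>k\<in>UNIV. f (Inr k))"
  for f :: "'a::finite + 'b::finite \<Rightarrow> 'c::comm_monoid_add"
  by (subst UNIV_Plus_UNIV[symmetric], subst sum.Plus) (simp_all add: comp_def)

text \<open>On the support \<open>w $ i = 1\<close>, so the added diagonal
  \<open>\<delta> $ i / w $ i\<close> merges with \<open>R\<close> into the original matrix.\<close>

lemma sub_obj_restrict:
  assumes dec: "Qmat M = R + diag_mat \<delta>" and bin: "\<And>i. w $ i \<in> {0, 1}"
  shows "sub_obj M R \<delta> w v = restrict_vec (pos_supp w) v \<bullet> (Qmat M *v restrict_vec (pos_supp w) v)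
      + gvec M \<bullet> restrict_vec (pos_supp w) v"
proof -
  have "(\<Sum>j\<in>pos_supp w. v $ i * (R $ i $ j + (if i = j then \<delta> $ i / w $ i else 0)) * v $ j)
      = v $ i * (Qmat M *v restrict_vec (pos_supp w) v) $ i" if "i \<in> pos_supp w" for i
  proof -
    have "w $ i = 1"
      using bin[of i] that by (simp add: pos_supp_def)
    then have "R $ i $ j + (if i = j then \<delta> $ i / w $ i else 0) = Qmat M $ i $ j" for j
      by (auto simp: dec diag_mat_def)
    then show ?thesis
      unfolding sum_row_restrict[symmetric] by (simp add: sum_distrib_left mult.assoc)
  qed
  then show ?thesis
    unfolding sub_obj_def by (simp add: inner_restrict_vec restrict_vec_inner_commute inner_commute
        inner_restrict_vec[of "Qmat M *v restrict_vec (pos_supp w) v" "pos_supp w" v] mult.commute)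
qed

lemma closed_miqp_feasible: "closed {y. miqp_feasible M x y}"
  unfolding miqp_feasible_def less_eq_vec_def
  by (intro closed_Collect_conj closed_Collect_const closed_Collect_all closed_Collect_le
      closed_Collect_eq continuous_intros)

text \<open>With \<open>x\<close> fixed at a binary \<open>w\<close>, the feasible \<open>y\<close>
  are exactly the zero extensions of subproblem points. Positive definiteness provides a minimiser
  among them, and \<open>quadratic_kkt\<close> the multipliers.\<close>

lemma ex_sub_primal_dual:
  fixes M :: "('n::finite, 'm1::finite, 'm2::finite) miqp"
  assumes Q: "pos_def (Qmat M)" and dec: "Qmat M = R + diag_mat \<delta>"
    and w: "w \<in> Xset M" and bin: "\<And>i. w $ i \<in> {0, 1}"
    and feas: "miqp_feasible M w y0"
  shows "\<exists>y lam mu. sub_primal_dual M R \<delta> w y lam mu"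
proof -
  let ?S = "pos_supp w"
  let ?r = "restrict_vec ?S"
  let ?f = "sub_obj M R \<delta> w"
  note f = sub_obj_restrict[OF dec bin]
  have feas_iff: "miqp_feasible M w y \<longleftrightarrow> sub_feasible M w y \<and> (\<forall>i. i \<notin> ?S \<longrightarrow> y $ i = 0)" for y
  proof -
    have "(\<forall>i. y $ i * (1 - w $ i) = 0) \<longleftrightarrow> (\<forall>i. i \<notin> ?S \<longrightarrow> y $ i = 0)"
    proof (intro iff_allI)
      show "y $ i * (1 - w $ i) = 0 \<longleftrightarrow> (i \<notin> ?S \<longrightarrow> y $ i = 0)" for i
        using bin[of i] by (auto simp: pos_supp_def)
    qed
    then show ?thesis
      using w restrict_vec_ident[of ?S y]
      by (auto simp: miqp_feasible_def sub_feasible_def sub_lhs_restrict)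
  qed
  have sub_r: "sub_feasible M w (?r z) \<longleftrightarrow> sub_feasible M w z" for z
    by (simp add: sub_feasible_def sub_lhs_restrict restrict_vec_ident[of ?S "?r z"])
  obtain y where y: "miqp_feasible M w y"
    and y_min: "\<And>z. miqp_feasible M w z
      \<Longrightarrow> y \<bullet> (Qmat M *v y) + gvec M \<bullet> y \<le> z \<bullet> (Qmat M *v z) + gvec M \<bullet> z"
    using pos_def_attains_min[OF Q closed_miqp_feasible, of M w "gvec M"] feas by auto
  have y0: "i \<notin> ?S \<Longrightarrow> y $ i = 0" for i
    using y feas_iff by blast
  then have ry: "?r y = y"
    by (rule restrict_vec_ident)
  have min: "?f y \<le> ?f z" if "sub_feasible M w z" for z
    unfolding f ry using that by (intro y_min) (simp add: feas_iff sub_r)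
  \<comment> \<open>The sum type indexes both groups of constraints at once. Rows are restricted to
    the support because the subproblem reads no other coordinates.\<close>
  define a :: "'m1 + 'm2 \<Rightarrow> real^'n" where
    "a = case_sum (\<lambda>k. ?r (row k (Amat M))) (\<lambda>k. ?r (row k (Cmat M)))"
  define b :: "'m1 + 'm2 \<Rightarrow> real" where
    "b = case_sum (\<lambda>k. bvec M $ k) (\<lambda>k. (Dmat M *v w) $ k)"
  \<comment> \<open>The gradient of \<open>sub_obj\<close> at \<open>y\<close>, hence zero off the
    support.\<close>
  define G where "G = ?r (2 *\<^sub>R (Qmat M *v y) + gvec M)"
  have row: "?r (row k H) \<bullet> z = sub_lhs H w z $ k" for k z and H :: "real^'n^'m"
    by (simp add: sub_lhs_restrict restrict_vec_inner_commute)
       (simp add: matrix_vector_mult_def row_def inner_vec_def)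
  have sub_iff: "sub_feasible M w z \<longleftrightarrow> (\<forall>k\<in>UNIV. a k \<bullet> z \<le> b k)" for z
    unfolding sub_feasible_def less_eq_vec_def a_def b_def
    by (simp add: row split_sum_all)
  have sym: "transpose (Qmat M) = Qmat M"
    using Q by (simp add: pos_def_def)
  have "\<exists>u. (\<forall>k\<in>UNIV. 0 \<le> u k) \<and> (\<forall>k\<in>UNIV. u k * (a k \<bullet> y - b k) = 0)
           \<and> G + (\<Sum>k\<in>UNIV. u k *\<^sub>R a k) = 0"
  proof (rule quadratic_kkt)
    show "finite (UNIV :: ('m1 + 'm2) set)" by simp
    show "a k \<bullet> y \<le> b k" for k
      using y feas_iff sub_iff by blast
    show "?f y \<le> ?f z" if "\<forall>k\<in>UNIV. a k \<bullet> z \<le> b k" for z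
      using min that sub_iff by blast
    show "?f (y + t *\<^sub>R d) = ?f y + t * (G \<bullet> d) + t\<^sup>2 * (?r d \<bullet> (Qmat M *v ?r d))" for t d
      unfolding f restrict_vec_add_scaleR ry quadratic_form_add[OF sym] G_def
        restrict_vec_inner_commute[of _ "2 *\<^sub>R (Qmat M *v y) + gvec M"]
      by (simp add: inner_add_left inner_add_right matrix_vector_mult_scaleR power2_eq_square
          inner_commute[of "?r d" "Qmat M *v y"] algebra_simps)
  qed
  then obtain u where u: "\<And>k. 0 \<le> u k" "\<And>k. u k * (a k \<bullet> y - b k) = 0"
    "G + (\<Sum>k\<in>UNIV. u k *\<^sub>R a k) = 0"
    by blast
  define lam :: "real^'m1" where "lam = (\<chi> k. u (Inl k))"
  define mu :: "real^'m2" where "mu = (\<chi> k. u (Inr k))"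
  have stat: "2 * (\<Sum>j\<in>?S. R $ i $ j * y $ j) + 2 * (\<delta> $ i / w $ i) * y $ i + gvec M $ i
        + lam \<bullet> column i (Amat M) + mu \<bullet> column i (Cmat M) = 0" if i: "i \<in> ?S" for i
  proof -
    have "w $ i = 1"
      using bin[of i] i by (simp add: pos_supp_def)
    moreover have "(diag_mat \<delta> *v y) $ i = \<delta> $ i * y $ i"
      by (simp add: diag_mat_def matrix_vector_mult_def if_distrib[of "\<lambda>r. r * _"] cong: if_cong)
    moreover have "(G + (\<Sum>k\<in>UNIV. u k *\<^sub>R a k)) $ i = 0"
      by (simp add: u(3))
    ultimately show ?thesis
      using i unfolding sum_row_restrict ry
      by (simp add: G_def sum_UNIV_Plus a_def lam_def mu_def row_def column_def inner_vec_def dec matrix_vector_mult_add_rdistrib algebra_simps)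
  qed
  have "sub_primal_dual M R \<delta> w y lam mu"
    unfolding sub_primal_dual_def
  proof (intro conjI allI impI ballI)
    show "sub_feasible M w y" using y feas_iff by blast
    show "0 \<le> lam" "0 \<le> mu"
      using u(1) by (simp_all add: lam_def mu_def less_eq_vec_def)
    show "lam $ k * (sub_lhs (Amat M) w y - bvec M) $ k = 0" for k
      using u(2)[of "Inl k"] by (simp add: a_def b_def lam_def row)
    show "mu $ k * (sub_lhs (Cmat M) w y - Dmat M *v w) $ k = 0" for k
      using u(2)[of "Inr k"] by (simp add: a_def b_def mu_def row)
  qed (use y0 min stat in auto)
  then show ?thesis by blast
qed

text \<open>The system is square in the coordinates off the support, and \<open>proc_defined\<close>
  says that its kernel is trivial.\<close>

lemma rank_one_system_solvable:
  fixes L :: "real^'k^'n"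
  assumes "proc_defined \<delta> L Perspective_Rank_One w"
  shows "\<exists>\<beta>. \<forall>i\<in>- pos_supp w. rank_one_lhs \<delta> L w \<beta> i = c i"
proof -
  \<comment> \<open>Completing the system by the identity on the support gives an endomorphism of
    the whole space, for which injectivity implies surjectivity.\<close>
  define F where "F \<beta> = (\<chi> i. if i \<in> pos_supp w then \<beta> $ i else rank_one_lhs \<delta> L w \<beta> i)" for \<beta>
  have "linear F"
  proof (rule linearI)
    show "F (u + v) = F u + F v" for u v
      by (simp add: F_def vec_eq_iff rank_one_lhs_def algebra_simps sum.distrib)
    show "F (r *\<^sub>R u) = r *\<^sub>R F u" for r u
      by (simp add: F_def vec_eq_iff rank_one_lhs_def algebra_simps sum_distrib_left)
  qed
  moreover have "\<beta> = 0" if "F \<beta> = 0" for \<beta>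
  proof -
    have F0: "(if i \<in> pos_supp w then \<beta> $ i else rank_one_lhs \<delta> L w \<beta> i) = 0" for i
      using that by (simp add: F_def vec_eq_iff)
    then have "\<forall>i\<in>- pos_supp w. rank_one_lhs \<delta> L w \<beta> i = 0"
      by (metis ComplD)
    with assms have "\<forall>i\<in>- pos_supp w. \<beta> $ i = 0"
      by simp
    with F0 show ?thesis
      by (metis ComplI vec_eq_iff zero_index)
  qed
  ultimately have "surj F"
    by (intro linear_inj_imp_surj) (simp_all add: linear_injective_0)
  then obtain \<beta> where "F \<beta> = (\<chi> i. c i)"
    by (metis surjD)
  then have "\<forall>i\<in>- pos_supp w. rank_one_lhs \<delta> L w \<beta> i = c i"
    by (auto simp: F_def vec_eq_iff split: if_splits)
  then show ?thesis by blast
qed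

lemma ex_cut:
  fixes M :: "('n::finite, 'm1::finite, 'm2::finite) miqp" and L :: "real^'k^'n"
  assumes pd: "sub_primal_dual M R \<delta> w y lam mu" and def: "proc_defined \<delta> L p w"
  shows "\<exists>\<tau>. is_cut M R \<delta> L p w \<tau>"
proof -
  let ?S = "pos_supp w"
  \<comment> \<open>The parameter \<open>t\<close> carries the part of the off-support formula in
    which the two procedures differ.\<close>
  define \<tau> where "\<tau> t = (\<chi> i. if i \<in> ?S
      then - \<delta> $ i * (y $ i)\<^sup>2 / (w $ i)\<^sup>2 - mu \<bullet> column i (Dmat M) + hvec M $ i
      else t i - mu \<bullet> column i (Dmat M) + hvec M $ i)" for t
  have on: "cut_on_support M \<delta> w y mu (\<tau> t)" for t
    by (simp add: cut_on_support_def \<tau>_def)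
  have off: "\<forall>i\<in>- ?S. \<tau> t $ i = t i - mu \<bullet> column i (Dmat M) + hvec M $ i" for t
    by (simp add: \<tau>_def)
  show ?thesis
  proof (cases p)
    case Perspective
    then have "perspective_cut M R \<delta> w
        (\<tau> (\<lambda>i. - \<delta> $ i / 4 * (1 / \<delta> $ i * cut_residual M R w y lam mu i)\<^sup>2))"
      using pd on off def unfolding perspective_cut_def Let_def by fastforce
    then show ?thesis
      using Perspective by auto
  next
    case Perspective_Rank_One
    obtain \<beta> where \<beta>: "\<forall>i\<in>- ?S. rank_one_lhs \<delta> L w \<beta> i = 2 * cut_residual M R w y lam mu i"
      using rank_one_system_solvable[of \<delta> L w "\<lambda>i. 2 * cut_residual M R w y lam mu i"]
        def Perspective_Rank_One by blast
    let ?t = "\<lambda>i. - \<delta> $ i / 4 * (1 / 2 * \<beta> $ i)\<^sup>2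
        - 1 / 4 * (\<Sum>k | k \<in> col_zeros L w \<and> L $ i $ k \<noteq> 0.
            (1 / (2 * real (col_nnz L k)) * (\<Sum>j\<in>- ?S. L $ j $ k * \<beta> $ j))\<^sup>2)"
    have "perspective_rank_one_cut M R \<delta> L w (\<tau> ?t)"
      unfolding perspective_rank_one_cut_def Let_def
      using pd on[of ?t] \<beta> off[of ?t] by blast
    then show ?thesis
      using Perspective_Rank_One by auto
  qed
qed

section \<open>Optimal values and bounds for a decomposed instance\<close>

locale miqp_decomposition =
  fixes M :: "('n::finite, 'm1::finite, 'm2::finite) miqp"
    and R :: "real^'n^'n" and \<delta> :: "real^'n" and L :: "real^'k^'n" and P :: "cut_proc set"
  assumes Q: "pos_def (Qmat M)"
    and bin: "\<And>x i. x \<in> Xset M \<Longrightarrow> x $ i \<in> {0, 1}"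
    and feasible: "\<exists>x y. miqp_feasible M x y"
    and dec: "Qmat M = R + diag_mat \<delta>"
    and \<delta>: "\<And>i. 0 \<le> \<delta> $ i"
    and R: "pos_semidef R"
    and rank_one_dec: "Perspective_Rank_One \<in> P \<Longrightarrow>
      \<exists>N. pos_semidef N \<and> R = (\<Sum>k\<in>UNIV. (\<chi> i j. L $ i $ k * L $ j $ k)) + N"
begin

abbreviation "fbar \<equiv> fbar_persp M R \<delta>"

lemma finite_Xset: "finite (Xset M)"
  by (rule finite_subset[OF _ finite_binary_vectors]) (use bin in auto)

lemma f_persp_Xset:
  "x \<in> Xset M \<Longrightarrow> f_persp M R \<delta> x y = (if miqp_feasible M x y then ereal (miqp_obj M x y) else \<infinity>)"
  by (rule f_persp_binary[OF dec _ bin])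

lemma miqp_opt_le: "miqp_feasible M x y \<Longrightarrow> miqp_opt M \<le> ereal (miqp_obj M x y)"
  unfolding miqp_opt_def miqp_obj_def by (rule INF_lower2[of "(x, y)"]) auto

lemma miqp_opt_greatest:
  "(\<And>x y. miqp_feasible M x y \<Longrightarrow> c \<le> ereal (miqp_obj M x y)) \<Longrightarrow> c \<le> miqp_opt M"
  unfolding miqp_opt_def miqp_obj_def by (rule INF_greatest) auto

lemma fbar_le: "miqp_feasible M x y \<Longrightarrow> fbar x \<le> ereal (miqp_obj M x y)"
  unfolding fbar_persp_def by (rule INF_lower2[of y]) (auto simp: f_persp_Xset miqp_feasible_def)

lemma miqp_opt_le_fbar: "x \<in> Xset M \<Longrightarrow> miqp_opt M \<le> fbar x"
  unfolding fbar_persp_def by (rule INF_greatest) (simp add: f_persp_Xset miqp_opt_le)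

lemma fbar_finite_feasible:
  assumes "x \<in> Xset M" "fbar x < \<infinity>"
  shows "\<exists>y. miqp_feasible M x y"
proof -
  obtain y where "f_persp M R \<delta> x y < \<infinity>"
    using assms(2) unfolding fbar_persp_def INF_less_iff by blast
  then show ?thesis
    using f_persp_Xset[OF assms(1), of y] by (auto split: if_splits)
qed

text \<open>Over the unit box, which contains the convex hull, the part depending on
  \<open>y\<close> is bounded below by positive definiteness, and the linear part in
  \<open>x\<close> by minus the sum of the absolute values of \<open>hvec M\<close>.\<close>

lemma eta_persp_bounded_below: "\<exists>B. ereal B \<le> eta_persp M R \<delta>"
proof -
  obtain B where B: "\<And>v. B \<le> v \<bullet> (Qmat M *v v) + gvec M \<bullet> v"
    using pos_def_bounded_below[OF Q] by blast
  have "x \<in> cbox 0 1" if "x \<in> Xset M" for x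
  proof -
    have "0 \<le> x $ i \<and> x $ i \<le> 1" for i
      using bin[OF that, of i] by auto
    then show ?thesis
      by (simp add: mem_box_cart)
  qed
  then have "convex hull Xset M \<subseteq> cbox 0 1"
    by (intro hull_minimal convex_box) blast
  then have box: "0 \<le> x $ i" "x $ i \<le> 1" if "x \<in> convex hull Xset M" for x i
    using that by (auto simp: mem_box_cart)
  have "ereal (B - (\<Sum>i\<in>UNIV. \<bar>hvec M $ i\<bar>)) \<le> f_persp M R \<delta> x y" if x: "x \<in> convex hull Xset M" for x y
  proof -
    have "- \<bar>hvec M $ i\<bar> \<le> hvec M $ i * x $ i" for i
    proof -
      have "\<bar>hvec M $ i * x $ i\<bar> \<le> \<bar>hvec M $ i\<bar>"
        using box[OF x, of i] by (simp add: abs_mult mult_left_le)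
      then show ?thesis by linarith
    qed
    then have "- (\<Sum>i\<in>UNIV. \<bar>hvec M $ i\<bar>) \<le> hvec M \<bullet> x"
      unfolding inner_vec_def sum_negf[symmetric] by (intro sum_mono) simp
    with B[of y] have "B - (\<Sum>i\<in>UNIV. \<bar>hvec M $ i\<bar>) \<le> miqp_obj M x y"
      by (simp add: miqp_obj_def)
    then show ?thesis
      using f_persp_ge[OF dec \<delta> box[OF x], of y] by (meson ereal_less_eq(3) order_trans)
  qed
  then show ?thesis
    unfolding eta_persp_def by (intro exI INF_greatest) auto
qed

lemma eta_persp_le: "miqp_feasible M x y \<Longrightarrow> eta_persp M R \<delta> \<le> ereal (miqp_obj M x y)"
  unfolding eta_persp_def
  by (rule INF_lower2[of "(x, y)"]) (auto simp: f_persp_Xset miqp_feasible_def hull_inc)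

text \<open>Finiteness of this value gives the master problem a real lower bound before any cut has
  been added.\<close>

lemma eta_persp_real: "\<exists>e. eta_persp M R \<delta> = ereal e"
proof -
  obtain x y where "miqp_feasible M x y"
    using feasible by blast
  from eta_persp_le[OF this] eta_persp_bounded_below show ?thesis
    by (cases "eta_persp M R \<delta>") auto
qed

section \<open>Validity of the cuts of both procedures\<close>

lemma sub_primal_dual_feasible:
  assumes "w \<in> Xset M" "sub_primal_dual M R \<delta> w y lam mu"
  shows "miqp_feasible M w y"
proof -
  have y0: "\<And>i. i \<notin> pos_supp w \<Longrightarrow> y $ i = 0" and feas: "sub_feasible M w y"
    using assms(2) unfolding sub_primal_dual_def by blast+
  have "y $ i * (1 - w $ i) = 0" for i
    using y0[of i] bin[OF assms(1), of i] by (auto simp: pos_supp_def)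
  then show ?thesis
    using feas assms(1) restrict_vec_ident[OF y0]
    by (simp add: miqp_feasible_def sub_feasible_def sub_lhs_restrict)
qed

text \<open>A vanishing sum of nonnegative numbers has only zero terms, so \<open>w\<close> is zero
  on the support of such a column.\<close>

lemma col_zeros_supp:
  assumes "w \<in> Xset M" "k \<in> col_zeros L w" "i \<in> pos_supp w"
  shows "L $ i $ k = 0"
proof (rule ccontr)
  assume "L $ i $ k \<noteq> 0"
  moreover have "\<And>l. 0 \<le> w $ l"
    using bin[OF assms(1)] by (metis insert_iff order.refl singletonD zero_le_one)
  ultimately have "w $ i = 0"
    using assms(2) by (simp add: col_zeros_def sum_nonneg_eq_0_iff)
  then show False
    using assms(3) by (simp add: pos_supp_def)
qed

text \<open>Expanding \<open>R\<close> writes the form as the sum of squares over all columns plus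
  the nonnegative form of \<open>N\<close>; restricting to \<open>K\<close> drops only nonnegative
  terms.\<close>

lemma rank_one_le:
  assumes "Perspective_Rank_One \<in> P"
  shows "(\<Sum>k\<in>K. (\<Sum>i\<in>UNIV. L $ i $ k * v $ i)\<^sup>2) \<le> v \<bullet> (R *v v)"
proof -
  obtain N where N: "pos_semidef N" "R = (\<Sum>k\<in>UNIV. (\<chi> i j. L $ i $ k * L $ j $ k)) + N"
    using rank_one_dec[OF assms] by blast
  have "v \<bullet> ((\<Sum>k\<in>UNIV. (\<chi> i j. L $ i $ k * L $ j $ k)) *v v)
      = (\<Sum>i\<in>UNIV. \<Sum>j\<in>UNIV. \<Sum>k\<in>UNIV. v $ i * (L $ i $ k * L $ j $ k * v $ j))"
    by (simp add: inner_vec_def matrix_vector_mult_def sum_distrib_left sum_distrib_right)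
  also have "\<dots> = (\<Sum>i\<in>UNIV. \<Sum>k\<in>UNIV. \<Sum>j\<in>UNIV. v $ i * (L $ i $ k * L $ j $ k * v $ j))"
    by (intro sum.cong refl sum.swap)
  also have "\<dots> = (\<Sum>k\<in>UNIV. \<Sum>i\<in>UNIV. \<Sum>j\<in>UNIV. v $ i * (L $ i $ k * L $ j $ k * v $ j))"
    by (rule sum.swap)
  also have "\<dots> = (\<Sum>k\<in>UNIV. (\<Sum>i\<in>UNIV. L $ i $ k * v $ i)\<^sup>2)"
    by (simp add: power2_eq_square sum_product mult_ac)
  finally have "v \<bullet> (R *v v) = (\<Sum>k\<in>UNIV. (\<Sum>i\<in>UNIV. L $ i $ k * v $ i)\<^sup>2) + v \<bullet> (N *v v)"
    by (simp add: N(2) matrix_vector_mult_add_rdistrib inner_add_right)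
  moreover have "(\<Sum>k\<in>K. (\<Sum>i\<in>UNIV. L $ i $ k * v $ i)\<^sup>2) \<le> (\<Sum>k\<in>UNIV. (\<Sum>i\<in>UNIV. L $ i $ k * v $ i)\<^sup>2)"
    by (intro sum_mono2) auto
  ultimately show ?thesis
    using N(1) by (simp add: pos_semidef_def add_increasing2)
qed

text \<open>The bound is stated with the value at the minimiser \<open>y\<close> from which the cut
  was built. As \<open>fbar w\<close> is at most that value, the cut used by the algorithm inherits
  the bound.\<close>

lemma cut_valid_ex:
  assumes w: "w \<in> Xset M" and p: "p \<in> P" and cut: "is_cut M R \<delta> L p w \<tau>"
  shows "\<exists>y. miqp_feasible M w y \<and>
    (\<forall>x z. miqp_feasible M x z \<longrightarrow> \<tau> \<bullet> (x - w) + miqp_obj M w y \<le> miqp_obj M x z)"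
proof -
  have sym: "transpose R = R" and psd: "\<And>v. 0 \<le> v \<bullet> (R *v v)"
    using R by (auto simp: pos_semidef_def)
  note ineq = cut_inequality[OF _ dec \<delta> sym _ _ w]
  show ?thesis
  proof (cases p)
    case Perspective
    with cut have cut': "perspective_cut M R \<delta> w \<tau>"
      by simp
    then have pos: "\<forall>i\<in>- pos_supp w. 0 < \<delta> $ i"
      unfolding perspective_cut_def by (rule conjunct1)
    from cut' obtain y lam mu where pd: "sub_primal_dual M R \<delta> w y lam mu"
      and on: "cut_on_support M \<delta> w y mu \<tau>"
      and off: "\<forall>i\<in>- pos_supp w. \<tau> $ i
        = - \<delta> $ i / 4 * (1 / \<delta> $ i * cut_residual M R w y lam mu i)\<^sup>2 - mu \<bullet> column i (Dmat M) + hvec M $ i"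
      unfolding perspective_cut_def Let_def by (elim conjE exE) (rule that)
    have "\<tau> \<bullet> (x - w) + miqp_obj M w y \<le> miqp_obj M x z" if "miqp_feasible M x z" for x z
    proof (rule ineq[where K = "{}" and L = L and \<psi> = "\<lambda>_. 0", OF _ _ _ pd on _ _ that])
      show "\<delta> $ i * (1 / \<delta> $ i * cut_residual M R w y lam mu i) + (\<Sum>k\<in>{}. L $ i $ k * 0)
          = cut_residual M R w y lam mu i" if "i \<notin> pos_supp w" for i
      proof -
        have "0 < \<delta> $ i"
          using pos that by blast
        then show ?thesis
          by simp
      qed
    qed (use bin psd off in auto)
    then show ?thesis
      using sub_primal_dual_feasible[OF w pd] by blast
  next
    case Perspective_Rank_One
    define \<psi> where "\<psi> \<beta> k = 1 / (2 * real (col_nnz L k)) * (\<Sum>j\<in>- pos_supp w. L $ j $ k * \<beta> $ j)"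
      for \<beta> k
    from Perspective_Rank_One cut have cut': "perspective_rank_one_cut M R \<delta> L w \<tau>"
      by simp
    then obtain y lam mu \<beta> where pd: "sub_primal_dual M R \<delta> w y lam mu"
      and on: "cut_on_support M \<delta> w y mu \<tau>"
      and lhs: "\<forall>i\<in>- pos_supp w. rank_one_lhs \<delta> L w \<beta> i = 2 * cut_residual M R w y lam mu i"
      and off: "\<forall>i\<in>- pos_supp w. \<tau> $ i = - \<delta> $ i / 4 * (1 / 2 * \<beta> $ i)\<^sup>2
        - 1 / 4 * (\<Sum>k | k \<in> col_zeros L w \<and> L $ i $ k \<noteq> 0. (\<psi> \<beta> k)\<^sup>2)
        - mu \<bullet> column i (Dmat M) + hvec M $ i"
      unfolding perspective_rank_one_cut_def Let_def by (elim conjE exE) (rule that[unfolded \<psi>_def])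
    have "\<tau> \<bullet> (x - w) + miqp_obj M w y \<le> miqp_obj M x z" if "miqp_feasible M x z" for x z
    proof (rule ineq[where K = "col_zeros L w" and L = L and \<psi> = "\<psi> \<beta>", OF _ _ _ pd on _ _ that])
      show "\<delta> $ i * (1 / 2 * \<beta> $ i) + (\<Sum>k\<in>col_zeros L w. L $ i $ k * \<psi> \<beta> k)
          = cut_residual M R w y lam mu i" if "i \<notin> pos_supp w" for i
      proof -
        \<comment> \<open>The factor 2 on the right of the linear system matches the factors 1/2 in
          both \<open>\<Psi>\<close> and \<open>\<psi>\<close>.\<close>
        have "rank_one_lhs \<delta> L w \<beta> i = 2 * (\<delta> $ i * (1 / 2 * \<beta> $ i) + (\<Sum>k\<in>col_zeros L w. L $ i $ k * \<psi> \<beta> k))"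
          unfolding rank_one_lhs_def \<psi>_def distrib_left sum_distrib_left
          by (intro arg_cong2[where f = "(+)"] sum.cong refl) (simp_all add: sum_distrib_left[symmetric])
        moreover have "rank_one_lhs \<delta> L w \<beta> i = 2 * cut_residual M R w y lam mu i"
          using lhs that by blast
        ultimately show ?thesis
          by simp
      qed
    qed (use bin off rank_one_le p Perspective_Rank_One col_zeros_supp[OF w] in auto)
    then show ?thesis
      using sub_primal_dual_feasible[OF w pd] by blast
  qed
qed

lemma cut_valid:
  assumes "w \<in> Xset M" "p \<in> P" "is_cut M R \<delta> L p w \<tau>" "miqp_feasible M x z"
  shows "ereal (\<tau> \<bullet> (x - w)) + fbar w \<le> ereal (miqp_obj M x z)"
proof -
  obtain y where y: "miqp_feasible M w y" "\<tau> \<bullet> (x - w) + miqp_obj M w y \<le> miqp_obj M x z"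
    using cut_valid_ex[OF assms(1-3)] assms(4) by blast
  have "ereal (\<tau> \<bullet> (x - w)) + fbar w \<le> ereal (\<tau> \<bullet> (x - w)) + ereal (miqp_obj M w y)"
    using fbar_le[OF y(1)] by (rule add_left_mono)
  also have "\<dots> \<le> ereal (miqp_obj M x z)"
    using y(2) by simp
  finally show ?thesis .
qed

lemma eta_persp_le_opt: "eta_persp M R \<delta> \<le> miqp_opt M"
  by (rule miqp_opt_greatest) (rule eta_persp_le)

text \<open>A cut at \<open>w\<close> comes with a feasible point, which bounds
  \<open>fbar w\<close> above; the relaxation value bounds it below.\<close>

lemma fbar_real:
  assumes "w \<in> Xset M" "p \<in> P" "is_cut M R \<delta> L p w \<tau>"
  shows "\<exists>c. fbar w = ereal c"
proof -
  obtain y where "miqp_feasible M w y"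
    using cut_valid_ex[OF assms] by blast
  from fbar_le[OF this] have "fbar w < \<infinity>"
    by (rule order.strict_trans1) simp
  moreover obtain e where "eta_persp M R \<delta> = ereal e"
    using eta_persp_real by blast
  then have "ereal e \<le> fbar w"
    using eta_persp_le_opt miqp_opt_le_fbar[OF assms(1)] by simp
  ultimately show ?thesis
    by (cases "fbar w") auto
qed

section \<open>Runs of the algorithm\<close>

text \<open>The invariant of a run that has not stopped before iteration \<open>t\<close>; it is
  shared by the lower bound on the optimum and the solvability of the next master problem.\<close>

definition valid_cuts :: "(nat \<Rightarrow> real^'n) \<Rightarrow> (nat \<Rightarrow> real^'n) \<Rightarrow> nat \<Rightarrow> bool" where
  "valid_cuts x \<tau> t \<longleftrightarrow> (\<forall>s\<in>{1..<t}. x s \<in> Xset M \<and> (\<exists>p\<in>P. is_cut M R \<delta> L p (x s) (\<tau> s)))"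

lemma feasible_in_region:
  assumes "valid_cuts x \<tau> t" "miqp_feasible M x' z"
  shows "(x', z, miqp_obj M x' z) \<in> oa_region M R \<delta> x \<tau> t"
  using assms eta_persp_le[OF assms(2)] cut_valid
  by (fastforce simp: oa_region_def oa_init_def oa_halfspace_def valid_cuts_def miqp_feasible_def hull_inc)

lemma master_le_opt:
  assumes "valid_cuts x \<tau> t" "master_solution M (oa_region M R \<delta> x \<tau> t) x' \<eta>'"
  shows "ereal \<eta>' \<le> miqp_opt M"
proof (rule miqp_opt_greatest)
  fix u z assume uz: "miqp_feasible M u z"
  then have "u \<in> Xset M"
    by (simp add: miqp_feasible_def)
  then show "ereal \<eta>' \<le> ereal (miqp_obj M u z)"
    using feasible_in_region[OF assms(1) uz] assms(2) unfolding master_solution_def by auto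
qed

text \<open>For a fixed binary \<open>u\<close> the least admissible height does not depend on
  \<open>y\<close>; it remains to minimise it over the finite nonempty set of those \<open>u\<close>
  that admit some \<open>y\<close>.\<close>

lemma ex_master_solution:
  assumes cuts: "valid_cuts x \<tau> t"
  shows "\<exists>x' \<eta>'. master_solution M (oa_region M R \<delta> x \<tau> t) x' \<eta>'"
proof -
  obtain e where e: "eta_persp M R \<delta> = ereal e"
    using eta_persp_real by blast
  have "\<forall>s\<in>{1..<t}. \<exists>c. fbar (x s) = ereal c"
    using cuts fbar_real unfolding valid_cuts_def by blast
  then obtain c where c: "\<And>s. s \<in> {1..<t} \<Longrightarrow> fbar (x s) = ereal (c s)"
    by metis
  \<comment> \<open>Inserting \<open>e\<close> accounts for the initial region and keeps the maximum
    defined at \<open>t = 1\<close>, when there are no cuts.\<close>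
  define m where "m u = Max (insert e ((\<lambda>s. \<tau> s \<bullet> (u - x s) + c s) ` {1..<t}))" for u
  define F where "F = {u \<in> Xset M. \<exists>y. Amat M *v y \<le> bvec M \<and> Cmat M *v y \<le> Dmat M *v u}"
  have region: "(u, y, \<eta>) \<in> oa_region M R \<delta> x \<tau> t
      \<longleftrightarrow> Amat M *v y \<le> bvec M \<and> Cmat M *v y \<le> Dmat M *v u \<and> m u \<le> \<eta>" if "u \<in> Xset M" for u y \<eta>
    using that by (auto simp: oa_region_def oa_init_def oa_halfspace_def e c m_def hull_inc)
  have "finite F" "F \<noteq> {}"
    using finite_Xset feasible by (auto simp: F_def miqp_feasible_def)
  then obtain u where u: "u \<in> F" "\<And>v. v \<in> F \<Longrightarrow> m u \<le> m v"
    using obtains_MIN by (metis arg_min_least arg_min_if_finite(1))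
  then obtain y where "(u, y, m u) \<in> oa_region M R \<delta> x \<tau> t"
    using region by (auto simp: F_def)
  moreover have "m u \<le> \<eta>'" if "x' \<in> Xset M" "(x', y', \<eta>') \<in> oa_region M R \<delta> x \<tau> t" for x' y' \<eta>'
  proof -
    have "x' \<in> F" "m x' \<le> \<eta>'"
      using that region[OF that(1)] by (auto simp: F_def)
    with u(2) show ?thesis
      by force
  qed
  ultimately have "master_solution M (oa_region M R \<delta> x \<tau> t) u (m u)"
    using u(1) by (auto simp: master_solution_def F_def)
  then show ?thesis by blast
qed

lemma valid_cutsI:
  assumes "\<And>s. s \<in> {1..<t} \<Longrightarrow> oa_iteration M R \<delta> L P x \<eta> \<tau> s \<and> \<not> oa_stops M R \<delta> (x s) (\<eta> s)"
  shows "valid_cuts x \<tau> t"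
  using assms unfolding valid_cuts_def oa_iteration_def master_solution_def by blast

text \<open>At a revisited point the linear term of the earlier cut vanishes, so the master value is
  at least \<open>fbar_persp\<close> there, which is the stopping test.\<close>

lemma no_repetition:
  assumes "oa_iteration M R \<delta> L P x \<eta> \<tau> t" "s \<in> {1..<t}" "x s = x t"
  shows "oa_stops M R \<delta> (x t) (\<eta> t)"
proof -
  obtain y where "(x t, y, \<eta> t) \<in> oa_region M R \<delta> x \<tau> t"
    using assms(1) by (auto simp: oa_iteration_def master_solution_def)
  then have "(x t, y, \<eta> t) \<in> oa_halfspace M R \<delta> (x s) (\<tau> s)"
    using assms(2) unfolding oa_region_def by blast
  then show ?thesis
    using assms(3) by (simp add: oa_halfspace_def oa_stops_def zero_ereal_def[symmetric])
qed

text \<open>An endless run would map the infinitely many iterations injectively into the finite set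
  \<open>Xset M\<close>.\<close>

lemma execution_stops:
  assumes exec: "oa_execution M R \<delta> L P x \<eta> \<tau>"
  shows "\<exists>t\<ge>1. oa_stops M R \<delta> (x t) (\<eta> t)"
proof (rule ccontr)
  assume "\<not> ?thesis"
  then have nostop: "\<And>t. 1 \<le> t \<Longrightarrow> \<not> oa_stops M R \<delta> (x t) (\<eta> t)"
    by blast
  then have it: "oa_iteration M R \<delta> L P x \<eta> \<tau> t" if "1 \<le> t" for t
    using exec that unfolding oa_execution_def by simp
  have "x s \<noteq> x t" if "1 \<le> s" "s < t" for s t
    using no_repetition[OF it, of t s] nostop[of t] that by auto
  then have "inj_on x {1..}"
    by (intro linorder_inj_onI) auto
  moreover have "x ` {1..} \<subseteq> Xset M"
    using it by (auto simp: oa_iteration_def master_solution_def)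
  ultimately have "finite {1::nat..}"
    using finite_Xset finite_imageD finite_subset by blast
  then show False
    using infinite_Ici by blast
qed

lemma execution_optimal:
  assumes exec: "oa_execution M R \<delta> L P x \<eta> \<tau>"
  shows "\<exists>T\<ge>1. (\<forall>t\<in>{1..<T}. \<not> oa_stops M R \<delta> (x t) (\<eta> t)) \<and>
               oa_stops M R \<delta> (x T) (\<eta> T) \<and> ereal (\<eta> T) = miqp_opt M"
proof -
  \<comment> \<open>The least stopping index is taken because an execution is constrained only up to
    its first stop.\<close>
  define T where "T = (LEAST t. 1 \<le> t \<and> oa_stops M R \<delta> (x t) (\<eta> t))"
  have "1 \<le> T" and stop: "oa_stops M R \<delta> (x T) (\<eta> T)"
    using execution_stops[OF exec] LeastI_ex[of "\<lambda>t. 1 \<le> t \<and> oa_stops M R \<delta> (x t) (\<eta> t)"]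
    by (auto simp: T_def)
  have before: "\<not> oa_stops M R \<delta> (x t) (\<eta> t)" if "t \<in> {1..<T}" for t
    using not_less_Least[of t "\<lambda>t. 1 \<le> t \<and> oa_stops M R \<delta> (x t) (\<eta> t)"] that by (auto simp: T_def)
  have it: "oa_iteration M R \<delta> L P x \<eta> \<tau> t" if "t \<in> {1..T}" for t
    using exec before that unfolding oa_execution_def by simp
  have master: "master_solution M (oa_region M R \<delta> x \<tau> T) (x T) (\<eta> T)"
    using it[of T] \<open>1 \<le> T\<close> by (simp add: oa_iteration_def)
  have "valid_cuts x \<tau> T"
    using it before by (intro valid_cutsI) auto
  from master_le_opt[OF this master] have "ereal (\<eta> T) \<le> miqp_opt M" .
  moreover have "miqp_opt M \<le> ereal (\<eta> T)"
    using miqp_opt_le_fbar[of "x T"] stop master unfolding oa_stops_def master_solution_def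
    by (meson order_trans)
  ultimately show ?thesis
    using \<open>1 \<le> T\<close> before stop by (intro exI[of _ T]) auto
qed

lemma unstopped_master_solution:
  assumes "oa_unstopped M R \<delta> L P x \<eta> \<tau> T"
  shows "\<exists>x' \<eta>'. master_solution M (oa_region M R \<delta> x \<tau> (T + 1)) x' \<eta>'"
  using assms unfolding oa_unstopped_def
  by (intro ex_master_solution valid_cutsI[where \<eta> = \<eta>]) auto

text \<open>Finiteness of \<open>fbar x\<close> provides a feasible \<open>y\<close>, without which
  the subproblem has no primal-dual solution.\<close>

lemma ex_cut_Xset:
  assumes "x \<in> Xset M" "fbar x < \<infinity>" "proc_defined \<delta> L p x"
  shows "\<exists>\<tau>. is_cut M R \<delta> L p x \<tau>"
proof -
  obtain y where y: "miqp_feasible M x y"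
    using fbar_finite_feasible assms by blast
  obtain y lam mu where "sub_primal_dual M R \<delta> x y lam mu"
    using ex_sub_primal_dual[OF Q dec assms(1) bin[OF assms(1)] y] by blast
  then show ?thesis
    using ex_cut assms(3) by blast
qed

end

text \<open>The first conjunct concerns executions that are given; the second shows that an
  unstopped run can be continued: the next master problem is solvable, and a cut exists wherever the
  chosen procedure is defined and \<open>fbar_persp\<close> is finite.\<close>

theorem theorem2:
  fixes M :: "('n::finite, 'm1::finite, 'm2::finite) miqp"
    and R N :: "real^'n^'n" and \<delta> :: "real^'n" and L :: "real^'k^'n"
    and P :: "cut_proc set"
  assumes "pos_def (Qmat M)"
    and "\<forall>x\<in>Xset M. \<forall>i. x $ i \<in> {0, 1}"
    and "\<exists>x y. miqp_feasible M x y"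
    and "Qmat M = R + diag_mat \<delta>"
    and "\<forall>i. 0 \<le> \<delta> $ i"
    and "pos_semidef R"
    and "Perspective_Rank_One \<in> P \<Longrightarrow>
           CARD('k) \<le> CARD('n) \<and> pos_semidef N \<and>
           R = (\<Sum>k\<in>UNIV. (\<chi> i j. L $ i $ k * L $ j $ k)) + N"
  shows
    "(\<forall>x \<eta> \<tau>. oa_execution M R \<delta> L P x \<eta> \<tau> \<longrightarrow>
        (\<exists>T\<ge>1. (\<forall>t\<in>{1..<T}. \<not> oa_stops M R \<delta> (x t) (\<eta> t)) \<and>
               oa_stops M R \<delta> (x T) (\<eta> T) \<and>
               ereal (\<eta> T) = miqp_opt M))
     \<and>
     (\<forall>x \<eta> \<tau> T. oa_unstopped M R \<delta> L P x \<eta> \<tau> T \<longrightarrow>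
        (\<exists>x' \<eta>'. master_solution M (oa_region M R \<delta> x \<tau> (T + 1)) x' \<eta>') \<and>
        (\<forall>x' \<eta>' p. master_solution M (oa_region M R \<delta> x \<tau> (T + 1)) x' \<eta>' \<and>
                   \<not> oa_stops M R \<delta> x' \<eta>' \<and>
                   p \<in> P \<and> proc_defined \<delta> L p x' \<and> fbar_persp M R \<delta> x' < \<infinity> \<longrightarrow>
           (\<exists>\<tau>'. is_cut M R \<delta> L p x' \<tau>')))"
proof -
  interpret miqp_decomposition M R \<delta> L P
    using assms by unfold_locales blast+
  show ?thesis
    using execution_optimal unstopped_master_solution ex_cut_Xset
    unfolding master_solution_def by blast
qed

end
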